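(* Let $M$ be a compact smooth manifold equipped with a Riemannian metric $g$, and let $f: M \to \mathbb{R}$ be a Morse function. Then for almost all $p \in M$ (that is, for all $p$ outside a subset of $M$ of measure zero), the gradient flow line $\gamma_p$ of $f$ with initial value $p$ converges to a local minimum of $f$ as $t \to \infty$.
   Context: A smooth function $f: M\to\mathbb{R}$ is a Morse function if all its critical points are non-degenerate, i.e. the Hessian of $f$ at each critical point is non-singular. The index of a critical point is the maximal dimension of a subspace on which the Hessian is negative definite; a critical point of index $0$ is called a local minimum of $f$. The gradient vector field $\nabla f$ is determined by $\langle \nabla f(p), v\rangle = d_pf(v)$ for all $p \in M$, $v \in T_pM$, where $\langle\cdot,\cdot\rangle$ is the Riemannian metric. A gradient flow line (GF) of $f$ is a curve $\gamma:(a,b)\to M$, $-\infty\le a<b\le\infty$, with $\dot\gamma(t) + \nabla f(\gamma(t)) = 0$; $\gamma_p$ denotes the solution with $\gamma_p(0)=p$. *)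

theory Defs
  imports "HOL-Analysis.Analysis"
begin

section \<open>Smooth maps between Euclidean spaces\<close>

text \<open>Only meant for open \<open>S\<close>: \<^term>\<open>frechet_derivative h (at x)\<close> is a full, not a relative,
  derivative.\<close>

primrec Ck_on :: "nat \<Rightarrow> 'a::euclidean_space set \<Rightarrow> ('a \<Rightarrow> 'b::real_normed_vector) \<Rightarrow> bool" where
  "Ck_on 0 S h \<longleftrightarrow> continuous_on S h"
| "Ck_on (Suc k) S h \<longleftrightarrow> (\<forall>x\<in>S. h differentiable (at x)) \<and>
     (\<forall>v. Ck_on k S (\<lambda>x. frechet_derivative h (at x) v))"

definition smooth_on :: "'a::euclidean_space set \<Rightarrow> ('a \<Rightarrow> 'b::real_normed_vector) \<Rightarrow> bool" where
  "smooth_on S h \<longleftrightarrow> (\<forall>k. Ck_on k S h)"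

section \<open>Smooth manifolds\<close>

text \<open>A chart is a pair of a domain \<open>U\<close> and a map \<open>\<phi>\<close>, of which only the values on \<open>U\<close> matter.
  The dimension of the manifold is \<open>DIM('e)\<close>, hence positive; there is no boundary. The underlying
  space is a subset \<open>M\<close> of a Hausdorff space, with the subspace topology.\<close>

type_synonym ('m, 'e) chart = "'m set \<times> ('m \<Rightarrow> 'e)"

abbreviation chart_inv :: "('m, 'e) chart \<Rightarrow> 'e \<Rightarrow> 'm" where
  "chart_inv c \<equiv> inv_into (fst c) (snd c)"

definition is_chart :: "'m::t2_space set \<Rightarrow> ('m, 'e::euclidean_space) chart \<Rightarrow> bool" where
  "is_chart M c \<longleftrightarrow> openin (top_of_set M) (fst c) \<and> open (snd c ` fst c) \<and>
     homeomorphism (fst c) (snd c ` fst c) (snd c) (chart_inv c)"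

definition smooth_manifold ::
    "'m::t2_space set \<Rightarrow> ('m, 'e::euclidean_space) chart set \<Rightarrow> bool" where
  "smooth_manifold M A \<longleftrightarrow>
     second_countable (top_of_set M) \<and>
     (\<forall>c\<in>A. is_chart M c) \<and>
     M = (\<Union>c\<in>A. fst c) \<and>
     (\<forall>c\<in>A. \<forall>c'\<in>A. smooth_on (snd c ` (fst c \<inter> fst c')) (snd c' \<circ> chart_inv c))"

definition smooth_function ::
    "('m, 'e::euclidean_space) chart set \<Rightarrow> ('m \<Rightarrow> real) \<Rightarrow> bool" where
  "smooth_function A f \<longleftrightarrow> (\<forall>c\<in>A. smooth_on (snd c ` fst c) (f \<circ> chart_inv c))"

text \<open>Measure zero in the sense of the Lebesgue measure in every chart.\<close>

definition measure_zero ::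
    "'m::t2_space set \<Rightarrow> ('m, 'e::euclidean_space) chart set \<Rightarrow> 'm set \<Rightarrow> bool" where
  "measure_zero M A N \<longleftrightarrow> N \<subseteq> M \<and> (\<forall>c\<in>A. negligible (snd c ` (N \<inter> fst c)))"

section \<open>Riemannian metrics\<close>

text \<open>A tangent vector at \<open>p\<close> is described by a chart \<open>c\<close> around \<open>p\<close> and its coordinate vector
  \<open>u\<close> in that chart; \<open>(c, u)\<close> and \<open>(c', u')\<close> describe the same tangent vector iff
  \<open>u' = coord_change c c' p u\<close>. A tensor at \<open>p\<close> is correspondingly given by its expression in
  each chart around \<open>p\<close>, subject to the transformation law.\<close>

definition coord_change ::
    "('m, 'e::euclidean_space) chart \<Rightarrow> ('m, 'e) chart \<Rightarrow> 'm \<Rightarrow> 'e \<Rightarrow> 'e" where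
  "coord_change c c' p = frechet_derivative (snd c' \<circ> chart_inv c) (at (snd c p))"

text \<open>\<open>g c p u v\<close> is the inner product of the two vectors in the tangent space at \<open>p\<close> whose
  coordinates in the chart \<open>c\<close> are \<open>u\<close> and \<open>v\<close>.\<close>

type_synonym ('m, 'e) metric_field = "('m, 'e) chart \<Rightarrow> 'm \<Rightarrow> 'e \<Rightarrow> 'e \<Rightarrow> real"

definition riemannian_metric ::
    "('m, 'e::euclidean_space) chart set \<Rightarrow> ('m, 'e) metric_field \<Rightarrow> bool" where
  "riemannian_metric A g \<longleftrightarrow>
     (\<forall>c\<in>A. \<forall>p\<in>fst c. bilinear (g c p) \<and> (\<forall>u v. g c p u v = g c p v u) \<and>
        (\<forall>u. u \<noteq> 0 \<longrightarrow> g c p u u > 0)) \<and>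
     (\<forall>c\<in>A. \<forall>c'\<in>A. \<forall>p\<in>fst c \<inter> fst c'. \<forall>u v.
        g c p u v = g c' p (coord_change c c' p u) (coord_change c c' p v)) \<and>
     (\<forall>c\<in>A. \<forall>u v. smooth_on (snd c ` fst c) (\<lambda>x. g c (chart_inv c x) u v))"

section \<open>Morse functions\<close>

definition differential ::
    "('m \<Rightarrow> real) \<Rightarrow> ('m, 'e::euclidean_space) chart \<Rightarrow> 'm \<Rightarrow> 'e \<Rightarrow> real" where
  "differential f c p = frechet_derivative (f \<circ> chart_inv c) (at (snd c p))"

definition critical_point ::
    "('m, 'e::euclidean_space) chart set \<Rightarrow> ('m \<Rightarrow> real) \<Rightarrow> 'm \<Rightarrow> bool" where
  "critical_point A f p \<longleftrightarrow> (\<exists>c\<in>A. p \<in> fst c) \<and>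
     (\<forall>c\<in>A. p \<in> fst c \<longrightarrow> (\<forall>v. differential f c p v = 0))"

text \<open>The second derivative in the chart \<open>c\<close>. It represents a bilinear form on the tangent space,
  independent of \<open>c\<close>, only at critical points, which is where it is used.\<close>

definition hessian ::
    "('m \<Rightarrow> real) \<Rightarrow> ('m, 'e::euclidean_space) chart \<Rightarrow> 'm \<Rightarrow> 'e \<Rightarrow> 'e \<Rightarrow> real" where
  "hessian f c p u v =
     frechet_derivative (\<lambda>x. frechet_derivative (f \<circ> chart_inv c) (at x) u) (at (snd c p)) v"

definition nondegenerate ::
    "('m, 'e::euclidean_space) chart set \<Rightarrow> ('m \<Rightarrow> real) \<Rightarrow> 'm \<Rightarrow> bool" where
  "nondegenerate A f p \<longleftrightarrow>
     (\<forall>c\<in>A. p \<in> fst c \<longrightarrow> (\<forall>u. (\<forall>v. hessian f c p u v = 0) \<longrightarrow> u = 0))"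

definition morse_function ::
    "('m, 'e::euclidean_space) chart set \<Rightarrow> ('m \<Rightarrow> real) \<Rightarrow> bool" where
  "morse_function A f \<longleftrightarrow>
     smooth_function A f \<and> (\<forall>p. critical_point A f p \<longrightarrow> nondegenerate A f p)"

text \<open>At a critical point every chart \<open>c\<close> around \<open>p\<close> contributes the same dimensions.\<close>

definition morse_index ::
    "('m, 'e::euclidean_space) chart set \<Rightarrow> ('m \<Rightarrow> real) \<Rightarrow> 'm \<Rightarrow> nat" where
  "morse_index A f p = Max {dim W |W c. c \<in> A \<and> p \<in> fst c \<and> subspace W \<and>
     (\<forall>w\<in>W. w \<noteq> 0 \<longrightarrow> hessian f c p w w < 0)}"

definition local_minimum ::
    "('m, 'e::euclidean_space) chart set \<Rightarrow> ('m \<Rightarrow> real) \<Rightarrow> 'm \<Rightarrow> bool" where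
  "local_minimum A f p \<longleftrightarrow> critical_point A f p \<and> morse_index A f p = 0"

section \<open>Gradient flow lines\<close>

text \<open>The coordinates of the gradient in the chart \<open>c\<close>.\<close>

definition gradient ::
    "('m, 'e) metric_field \<Rightarrow> ('m \<Rightarrow> real) \<Rightarrow> ('m, 'e::euclidean_space) chart \<Rightarrow> 'm \<Rightarrow> 'e" where
  "gradient g f c p = (THE w. \<forall>v. g c p w v = differential f c p v)"

text \<open>\<open>\<gamma>\<close> is only relevant on the open interval from \<open>a\<close> to \<open>b\<close>. Its continuity makes
  \<open>snd c \<circ> \<gamma>\<close> meaningful in a neighbourhood of \<open>t\<close>.\<close>

definition gradient_flow_line ::
    "'m::t2_space set \<Rightarrow> ('m, 'e::euclidean_space) chart set \<Rightarrow> ('m, 'e) metric_field \<Rightarrow>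
     ('m \<Rightarrow> real) \<Rightarrow> ereal \<Rightarrow> ereal \<Rightarrow> (real \<Rightarrow> 'm) \<Rightarrow> bool" where
  "gradient_flow_line M A g f a b \<gamma> \<longleftrightarrow> a < b \<and>
     continuous_on (einterval a b) \<gamma> \<and> \<gamma> ` einterval a b \<subseteq> M \<and>
     (\<forall>t\<in>einterval a b. \<forall>c\<in>A. \<gamma> t \<in> fst c \<longrightarrow>
        ((snd c \<circ> \<gamma>) has_vector_derivative (- gradient g f c (\<gamma> t))) (at t))"

end

theory Submission
  imports Defs
begin

text \<open>Along a flow line \<open>f\<close> decreases, at a rate bounded below near any point that is not critical, so
every cluster point of the flow line as \<open>t \<rightarrow> \<infinity>\<close> is critical (\<open>cluster_point_critical\<close>).
Non-degenerate critical points are isolated, and a flow line that kept leaving a small ball around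
one of them after entering it would cluster on an annulus free of critical points. Hence every
flow line converges to one of the finitely many critical points (\<open>flow_converges\<close>,
\<open>finite_critical\<close>). What remains is that the points attracted by a critical point \<open>q\<close> of
positive index form a null set (\<open>stable_set_measure_zero\<close>).

The reason is an expansion estimate. In a chart around \<open>q\<close>
let \<open>F\<close> be the coordinate gradient and \<open>H\<close> the Hessian of \<open>f\<close> at \<open>q\<close>. Since \<open>F\<close> is
\<open>G\<^sup>-\<^sup>1 H\<close> to first order, where \<open>G\<close> is the metric, non-degeneracy gives
\<open>H (F x - F y) (x - y) \<ge> c \<bar>x - y\<bar>\<^sup>2\<close> for \<open>x\<close> and \<open>y\<close> near \<open>q\<close> (\<open>hessian_expands\<close>). For two flow
lines \<open>x\<close> and \<open>y\<close> that stay near \<open>q\<close> forever, the quantity \<open>P = H (x - y) (x - y)\<close> therefore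
satisfies \<open>P' \<le> - 2 c \<bar>x - y\<bar>\<^sup>2\<close>; if it were negative at some time it would tend to \<open>-\<infinity>\<close>, although
it is bounded. So \<open>H\<close> is non-negative on all differences of points of the set of trapped initial
values. A direction \<open>w\<close> with \<open>H w w < 0\<close>, which exists because the index is positive, then exhibits
this set as a Lipschitz graph over a part of the hyperplane orthogonal to \<open>w\<close>, and such a graph is
negligible (\<open>trapped_set_negligible\<close>).

A flow line that converges to \<open>q\<close> is trapped after finitely many time steps of a fixed length. By
Gronwall's inequality the flow, run backwards for one short time step, is Lipschitz in
coordinates, so it maps null sets to null sets (\<open>flow_preimage_measure_zero\<close>); this is a
statement about pairs of flow lines, and so the flow map does not appear as a function. Global
existence is Picard iteration in charts, for a length of time that compactness makes uniform,
followed by gluing.\<close>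

section \<open>Curves with Lipschitz velocity in Euclidean space\<close>

text \<open>The inverse of \<open>k\<close> is Lipschitz, and Lipschitz maps preserve null sets. This is used with \<open>k\<close> the orthogonal projection to a
hyperplane and with \<open>k\<close> the time-\<open>h\<close> flow.\<close>

lemma negligible_if_expanding_into_negligible:
  fixes B E :: "'e::euclidean_space set"
  assumes "negligible E" and into: "\<And>b. b \<in> B \<Longrightarrow> k b \<in> E"
    and expand: "\<And>b b'. b \<in> B \<Longrightarrow> b' \<in> B \<Longrightarrow> norm (b - b') \<le> C * norm (k b - k b')"
  shows "negligible B"
proof -
  have inj: "inj_on k B"
    using expand by (fastforce intro: inj_onI)
  have neg: "negligible (k ` B)"
    using assms(1) into by (meson image_subsetI negligible_subset)
  have "\<exists>T C. open T \<and> x \<in> T \<and>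
      (\<forall>y\<in>k ` B \<inter> T. norm (inv_into B k y - inv_into B k x) \<le> C * norm (y - x))" if "x \<in> k ` B" for x
    using that expand inj by (intro exI[of _ UNIV] exI[of _ C]) auto
  then have "negligible (inv_into B k ` k ` B)"
    using negligible_locally_Lipschitz_image[OF order_refl neg, of "inv_into B k"] by blast
  then show ?thesis
    using inj by simp
qed

lemma norm_diff_le_speed:
  fixes x :: "real \<Rightarrow> 'e::real_normed_vector"
  assumes "convex S" and deriv: "\<And>t. t \<in> S \<Longrightarrow> (x has_vector_derivative x' t) (at t within S)"
    and speed: "\<And>t. t \<in> S \<Longrightarrow> norm (x' t) \<le> K" and "s \<in> S" "t \<in> S"
  shows "norm (x s - x t) \<le> K * \<bar>s - t\<bar>"
proof -
  have "norm (x s - x t) \<le> K * norm (s - t)"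
  proof (rule differentiable_bound[OF \<open>convex S\<close>, where f' = "\<lambda>t a. a *\<^sub>R x' t"])
    show "(x has_derivative (\<lambda>a. a *\<^sub>R x' u)) (at u within S)" if "u \<in> S" for u
      using deriv[OF that] by (simp add: has_vector_derivative_def)
    show "onorm (\<lambda>a. a *\<^sub>R x' u) \<le> K" if "u \<in> S" for u
      using speed[OF that] by (intro onorm_le) (simp add: mult.commute[of K] mult_left_mono)
  qed (use assms in auto)
  then show ?thesis by simp
qed

lemma decrease_at_rate:
  fixes \<psi> :: "real \<Rightarrow> real"
  assumes "a \<le> b"
    and deriv: "\<And>t. t \<in> {a..b} \<Longrightarrow> (\<psi> has_real_derivative \<psi>' t) (at t within {a..b})"
    and rate: "\<And>t. t \<in> {a..b} \<Longrightarrow> \<psi>' t \<le> - k"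
  shows "\<psi> b \<le> \<psi> a - k * (b - a)"
proof -
  obtain t where t: "t \<in> {a..b}" "\<psi> b - \<psi> a = \<psi>' t * (b - a)"
    using mvt_very_simple[OF \<open>a \<le> b\<close>, of \<psi> "\<lambda>t. (*) (\<psi>' t)"] deriv
    by (auto simp: has_field_derivative_def)
  have "\<psi>' t * (b - a) \<le> - k * (b - a)"
    using rate[OF t(1)] \<open>a \<le> b\<close> by (intro mult_right_mono) auto
  then show ?thesis using t(2) by simp
qed

text \<open>Gronwall's inequality backwards in time, for a pair of curves instead of a flow: \<open>L\<close> bounds the
growth of the vector field between the two curves, and then \<open>exp (2 L t) \<bar>x t - y t\<bar>\<^sup>2\<close> is
nondecreasing.\<close>

lemma backward_Lipschitz:
  fixes x y :: "real \<Rightarrow> 'e::real_inner"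
  assumes "0 \<le> h"
    and x: "\<And>t. t \<in> {0..h} \<Longrightarrow> (x has_vector_derivative x' t) (at t within {0..h})"
    and y: "\<And>t. t \<in> {0..h} \<Longrightarrow> (y has_vector_derivative y' t) (at t within {0..h})"
    and L: "\<And>t. t \<in> {0..h} \<Longrightarrow> norm (x' t - y' t) \<le> L * norm (x t - y t)"
  shows "norm (x 0 - y 0) \<le> exp (L * h) * norm (x h - y h)"
proof -
  define z where "z t = x t - y t" for t
  define z' where "z' t = x' t - y' t" for t
  define E where "E t = exp (2 * L * t) * (z t \<bullet> z t)" for t
  define E' where "E' t = exp (2 * L * t) * (2 * L * (z t \<bullet> z t) + 2 * (z t \<bullet> z' t))" for t
  have z: "(z has_vector_derivative z' t) (at t within {0..h})" if "t \<in> {0..h}" for t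
    unfolding z_def z'_def using x[OF that] y[OF that] by (auto intro!: derivative_eq_intros)
  have E: "(E has_real_derivative E' t) (at t within {0..h})" if "t \<in> {0..h}" for t
  proof -
    have "((\<lambda>t. z t \<bullet> z t) has_vector_derivative 2 * (z t \<bullet> z' t)) (at t within {0..h})"
      using bounded_bilinear.has_vector_derivative[OF bounded_bilinear_inner z[OF that] z[OF that]]
      by (simp add: inner_commute)
    then have "((\<lambda>t. z t \<bullet> z t) has_real_derivative 2 * (z t \<bullet> z' t)) (at t within {0..h})"
      by (simp add: has_real_derivative_iff_has_vector_derivative)
    then show ?thesis
      unfolding E_def E'_def by (auto intro!: derivative_eq_intros simp: algebra_simps)
  qed
  have "E' t \<ge> 0" if "t \<in> {0..h}" for t
  proof -
    have "- (z t \<bullet> z' t) \<le> norm (z t) * norm (z' t)"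
      using Cauchy_Schwarz_ineq2[of "z t" "z' t"] by linarith
    also have "\<dots> \<le> norm (z t) * (L * norm (z t))"
      using L[OF that] by (intro mult_left_mono) (auto simp: z_def z'_def)
    also have "\<dots> = L * (z t \<bullet> z t)"
      by (simp add: dot_square_norm power2_eq_square)
    finally show ?thesis
      by (simp add: E'_def)
  qed
  then have "- E h \<le> - E 0 - 0 * (h - 0)"
    using E \<open>0 \<le> h\<close> by (intro decrease_at_rate[where \<psi>' = "\<lambda>t. - E' t"]) (auto intro!: derivative_eq_intros)
  then have "norm (z 0) ^ 2 \<le> (exp (L * h) * norm (z h)) ^ 2"
    by (simp add: E_def dot_square_norm power_mult_distrib exp_of_nat_mult[symmetric] mult.assoc)
  then show ?thesis
    using power2_le_imp_le by (fastforce simp: z_def)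
qed

text \<open>Picard's theorem in a ball. Composing \<open>F\<close> with the projection to the ball makes it globally
Lipschitz and bounded without changing it on the ball, so that the integral operator can act on all
bounded continuous curves; the bound on \<open>K * h\<close> keeps the solution in the ball. The integral starts
at \<open>-h\<close> rather than at \<open>0\<close>, which treats both time directions alike but puts a difference of
two integrals over up to \<open>2 h\<close> and \<open>h\<close> into the operator: hence the small bound on \<open>L * h\<close>.\<close>

lemma flow_in_ball_exists:
  fixes F :: "'e::euclidean_space \<Rightarrow> 'e"
  assumes "0 \<le> K" "0 \<le> L" "0 < r" "0 < h"
    and bounded: "\<And>x. x \<in> cball x0 r \<Longrightarrow> norm (F x) \<le> K"
    and Lipschitz: "\<And>x y. x \<in> cball x0 r \<Longrightarrow> y \<in> cball x0 r \<Longrightarrow> norm (F x - F y) \<le> L * norm (x - y)"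
    and a: "a \<in> ball x0 (r/2)" and Kh: "K * h \<le> r/2" and Lh: "L * h \<le> 1/8"
  shows "\<exists>x. x 0 = a \<and> (\<forall>t\<in>{-h..h}. x t \<in> cball x0 r \<and>
           (x has_vector_derivative F (x t)) (at t within {-h..h}))"
proof -
  define Ft where "Ft y = F (closest_point (cball x0 r) y)" for y
  have cp: "closest_point (cball x0 r) y \<in> cball x0 r" for y
    using \<open>0 < r\<close> by (intro closest_point_in_set) auto
  have Ft_bound: "norm (Ft y) \<le> K" for y
    unfolding Ft_def by (rule bounded[OF cp])
  have Ft_Lip: "norm (Ft y - Ft z) \<le> L * norm (y - z)" for y z
  proof -
    have "norm (Ft y - Ft z) \<le> L * dist (closest_point (cball x0 r) y) (closest_point (cball x0 r) z)"
      unfolding Ft_def dist_norm by (rule Lipschitz[OF cp cp])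
    also have "\<dots> \<le> L * dist y z"
      using \<open>0 \<le> L\<close> \<open>0 < r\<close> by (intro mult_left_mono closest_point_lipschitz) auto
    finally show ?thesis by (simp add: dist_norm)
  qed
  have Ft_cont: "continuous_on UNIV Ft"
  proof -
    have "L-lipschitz_on UNIV Ft"
      using \<open>0 \<le> L\<close> Ft_Lip by (intro lipschitz_onI) (auto simp: dist_norm)
    then show ?thesis by (rule lipschitz_on_continuous_on)
  qed
  \<comment> \<open>Clamping the time turns curves on \<open>{-h..h}\<close> into bounded continuous functions on the line.\<close>
  define c where "c t = max (-h) (min h t)" for t :: real
  have c: "c t \<in> {-h..h}" for t using \<open>0 < h\<close> by (auto simp: c_def)
  have c_id: "c t = t" if "t \<in> {-h..h}" for t using that by (auto simp: c_def)
  define I where "I u t = integral {-h..t} (\<lambda>s. Ft (apply_bcontfun u s))" for u t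
  have Ftu: "continuous_on S (\<lambda>s. Ft (apply_bcontfun u s))" for u :: "real \<Rightarrow>\<^sub>C 'e" and S
    by (intro continuous_on_compose2[OF Ft_cont]) auto
  have Ftu_int: "(\<lambda>s. Ft (apply_bcontfun u s)) integrable_on {t..t'}"
    for u :: "real \<Rightarrow>\<^sub>C 'e" and t t'
    by (intro integrable_continuous_interval Ftu)
  have I_bound: "norm (I u t) \<le> K * (2 * h)" if "t \<in> {-h..h}" for u t
  proof -
    have "norm (I u t) \<le> K * (t - (-h))"
      unfolding I_def using that Ft_bound Ftu by (intro integral_bound) auto
    also have "\<dots> \<le> K * (2 * h)"
      using that \<open>0 \<le> K\<close> by (intro mult_left_mono) auto
    finally show ?thesis .
  qed
  have I_diff: "norm (I u t - I v t) \<le> L * dist u v * (2 * h)" if "t \<in> {-h..h}" for u v t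
  proof -
    have "I u t - I v t = integral {-h..t} (\<lambda>s. Ft (apply_bcontfun u s) - Ft (apply_bcontfun v s))"
      unfolding I_def by (intro integral_diff[symmetric] Ftu_int)
    also have "norm \<dots> \<le> (L * dist u v) * (t - (-h))"
    proof (rule integral_bound)
      show "norm (Ft (apply_bcontfun u s) - Ft (apply_bcontfun v s)) \<le> L * dist u v" for s
        using Ft_Lip[of "apply_bcontfun u s" "apply_bcontfun v s"]
          mult_left_mono[OF dist_bounded[of u s v] \<open>0 \<le> L\<close>] by (simp add: dist_norm)
    qed (use that Ftu in \<open>auto intro!: continuous_intros\<close>)
    also have "\<dots> \<le> (L * dist u v) * (2 * h)"
      using that \<open>0 \<le> L\<close> by (intro mult_left_mono) auto
    finally show ?thesis .
  qed
  have I_deriv: "(I u has_vector_derivative Ft (apply_bcontfun u t)) (at t within {-h..h})"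
    if "t \<in> {-h..h}" for u t
    unfolding I_def using integral_has_vector_derivative[OF Ftu that] .
  have I_cont: "continuous_on {-h..h} (I u)" for u
    using I_deriv by (meson continuous_on_vector_derivative)
  define \<Phi> where "\<Phi> u = Bcontfun (\<lambda>t. a + (I u (c t) - I u 0))" for u
  have \<Phi>: "apply_bcontfun (\<Phi> u) t = a + (I u (c t) - I u 0)" for u t
  proof -
    have "(\<lambda>t. a + (I u (c t) - I u 0)) \<in> bcontfun"
    proof (rule bcontfun_normI)
      show "continuous_on UNIV (\<lambda>t. a + (I u (c t) - I u 0))"
        using c by (intro continuous_intros continuous_on_compose2[OF I_cont])
          (auto simp: c_def intro!: continuous_intros)
      show "norm (a + (I u (c t) - I u 0)) \<le> norm a + (K * (2 * h) + K * (2 * h))" for t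
        using I_bound[OF c, of u t] I_bound[of 0 u] \<open>0 < h\<close>
        by (intro norm_triangle_le add_left_mono norm_triangle_le_diff) auto
    qed
    then show ?thesis unfolding \<Phi>_def by (simp add: Bcontfun_inverse)
  qed
  have "dist (\<Phi> u) (\<Phi> v) \<le> (L * h * 4) * dist u v" for u v
  proof (rule dist_bound)
    fix t
    have "dist (apply_bcontfun (\<Phi> u) t) (apply_bcontfun (\<Phi> v) t)
        = norm ((I u (c t) - I v (c t)) - (I u 0 - I v 0))"
      by (simp add: \<Phi> dist_norm algebra_simps)
    also have "\<dots> \<le> L * dist u v * (2 * h) + L * dist u v * (2 * h)"
      using I_diff[OF c, of u t v] I_diff[of 0 u v] \<open>0 < h\<close>
      by (intro order_trans[OF norm_triangle_ineq4 add_mono]) auto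
    finally show "dist (apply_bcontfun (\<Phi> u) t) (apply_bcontfun (\<Phi> v) t) \<le> (L * h * 4) * dist u v"
      by (simp add: algebra_simps)
  qed
  then have "\<exists>!u. \<Phi> u = u"
    using \<open>0 \<le> L\<close> \<open>0 < h\<close> Lh by (intro banach_fix_type[of "L * h * 4"]) auto
  then obtain u where u: "\<Phi> u = u" by blast
  define x where "x = apply_bcontfun u"
  have x: "x t = a + (I u t - I u 0)" if "t \<in> {-h..h}" for t
    using \<Phi>[of u t] c_id[OF that] by (simp add: u x_def)
  have deriv: "(x has_vector_derivative Ft (x t)) (at t within {-h..h})" if "t \<in> {-h..h}" for t
  proof (rule has_vector_derivative_transform[OF that x])
    show "((\<lambda>t. a + (I u t - I u 0)) has_vector_derivative Ft (x t)) (at t within {-h..h})"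
      using I_deriv[OF that, of u] unfolding x_def by (auto intro!: derivative_eq_intros)
  qed
  have "x 0 = a" using x[of 0] \<open>0 < h\<close> by simp
  have x_in: "x t \<in> cball x0 r" if "t \<in> {-h..h}" for t
  proof -
    have "norm (x t - x 0) \<le> K * \<bar>t - 0\<bar>"
      using that Ft_bound by (intro norm_diff_le_speed[OF convex_real_interval(5) deriv]) auto
    also have "\<dots> \<le> K * h"
      using that \<open>0 \<le> K\<close> by (intro mult_left_mono) auto
    finally have "dist x0 (x t) \<le> dist x0 a + r/2"
      using Kh dist_triangle[of x0 "x t" a] by (simp add: \<open>x 0 = a\<close> dist_norm norm_minus_commute)
    then show ?thesis using a by simp
  qed
  have "Ft (x t) = F (x t)" if "t \<in> {-h..h}" for t
    unfolding Ft_def using closest_point_self[OF x_in[OF that]] by simp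
  then show ?thesis
    using deriv x_in \<open>x 0 = a\<close> by (intro exI[of _ x]) metis
qed

section \<open>Continuously differentiable functions\<close>

text \<open>The local estimates below all hold on \<open>cball x0 r\<close> for small \<open>r\<close>. Stating them with the filter
\<open>at_right 0\<close> in \<open>r\<close> allows combining finitely many of them without handling minima of radii.\<close>

lemma eventually_all_in_cball:
  fixes x0 :: "'a::metric_space"
  assumes "\<forall>\<^sub>F x in nhds x0. P x"
  shows "\<forall>\<^sub>F r in at_right 0. \<forall>x\<in>cball x0 r. P x"
proof -
  obtain d where "d > 0" "\<And>x. dist x x0 < d \<Longrightarrow> P x"
    using assms by (auto simp: eventually_nhds_metric)
  then show ?thesis
    unfolding eventually_at_right_field by (auto simp: dist_commute intro!: exI[of _ d])
qed

lemma linear_abs_bound: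
  fixes l :: "'e::euclidean_space \<Rightarrow> real"
  assumes "linear l"
  shows "\<bar>l v\<bar> \<le> (\<Sum>b\<in>Basis. \<bar>l b\<bar>) * norm v"
proof -
  have "\<bar>l v\<bar> = \<bar>\<Sum>b\<in>Basis. (v \<bullet> b) * l b\<bar>"
    by (subst (1) euclidean_representation[symmetric, of v])
      (simp add: linear_sum[OF assms] linear_scale[OF assms])
  also have "\<dots> \<le> (\<Sum>b\<in>Basis. norm v * \<bar>l b\<bar>)"
    by (intro order_trans[OF sum_abs] sum_mono) (auto simp: abs_mult Basis_le_norm intro!: mult_right_mono)
  finally show ?thesis by (simp add: sum_distrib_left mult.commute)
qed

lemma bilinear_abs_bound:
  fixes B :: "'e::euclidean_space \<Rightarrow> 'e \<Rightarrow> real"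
  assumes "bilinear B"
  shows "\<bar>B u v\<bar> \<le> (\<Sum>b\<in>Basis. \<Sum>b'\<in>Basis. \<bar>B b b'\<bar>) * norm u * norm v"
proof -
  have "\<bar>B u v\<bar> \<le> (\<Sum>b\<in>Basis. \<bar>B b v\<bar>) * norm u"
    using assms by (intro linear_abs_bound) (simp add: bilinear_def)
  also have "\<dots> \<le> (\<Sum>b\<in>Basis. (\<Sum>b'\<in>Basis. \<bar>B b b'\<bar>) * norm v) * norm u"
    using assms by (intro mult_right_mono sum_mono linear_abs_bound) (auto simp: bilinear_def)
  also have "\<dots> = (\<Sum>b\<in>Basis. \<Sum>b'\<in>Basis. \<bar>B b b'\<bar>) * norm u * norm v"
    by (simp add: sum_distrib_right[symmetric])
  finally show ?thesis .
qed

text \<open>A continuous derivative is a strict derivative: the mean value inequality applies to \<open>h\<close> minus its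
linear part at \<open>x0\<close>, whose derivative is small near \<open>x0\<close>.\<close>

lemma Ck_on_1_strict_derivative:
  fixes h :: "'e::euclidean_space \<Rightarrow> real"
  assumes C1: "Ck_on (Suc 0) S h" and "open S" "x0 \<in> S" "0 < e"
  shows "\<forall>\<^sub>F r in at_right 0. \<forall>x\<in>cball x0 r. \<forall>y\<in>cball x0 r.
           \<bar>h x - h y - frechet_derivative h (at x0) (x - y)\<bar> \<le> e * norm (x - y)"
proof -
  let ?D = "\<lambda>x. frechet_derivative h (at x)"
  have diff: "(h has_derivative ?D x) (at x)" if "x \<in> S" for x
    using C1 that by (simp add: frechet_derivative_works)
  have "\<forall>\<^sub>F x in nhds x0. \<bar>?D x b - ?D x0 b\<bar> < e / DIM('e)" for b
  proof -
    have "isCont (\<lambda>x. ?D x b) x0"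
      using C1 \<open>open S\<close> \<open>x0 \<in> S\<close> by (simp add: continuous_on_eq_continuous_at)
    then have "((\<lambda>x. ?D x b) \<longlongrightarrow> ?D x0 b) (nhds x0)"
      using tendsto_at_iff_tendsto_nhds[of "\<lambda>x. ?D x b" x0] unfolding isCont_def by blast
    moreover have "e / DIM('e) > 0"
      using \<open>0 < e\<close> by simp
    ultimately show ?thesis
      unfolding tendsto_iff dist_real_def by blast
  qed
  then have "\<forall>\<^sub>F x in nhds x0. x \<in> S \<and> (\<forall>b\<in>Basis. \<bar>?D x b - ?D x0 b\<bar> < e / DIM('e))"
    using \<open>open S\<close> \<open>x0 \<in> S\<close>
    by (intro eventually_conj eventually_ball_finite eventually_nhds_in_open) auto
  then show ?thesis
  proof (rule eventually_mono[OF eventually_all_in_cball], intro ballI)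
    fix r x y assume close: "\<forall>x\<in>cball x0 r. x \<in> S \<and> (\<forall>b\<in>Basis. \<bar>?D x b - ?D x0 b\<bar> < e / DIM('e))"
      and xy: "x \<in> cball x0 r" "y \<in> cball x0 r"
    have "norm ((h x - ?D x0 x) - (h y - ?D x0 y)) \<le> e * norm (x - y)"
    proof (rule differentiable_bound[OF convex_cball _ _ xy, where f' = "\<lambda>z v. ?D z v - ?D x0 v"])
      fix z assume "z \<in> cball x0 r"
      then have z: "z \<in> S" "\<And>b. b \<in> Basis \<Longrightarrow> \<bar>?D z b - ?D x0 b\<bar> \<le> e / DIM('e)"
        using close by (auto simp: less_imp_le)
      have bl: "bounded_linear (?D x0)" "bounded_linear (?D z)"
        using diff z(1) \<open>x0 \<in> S\<close> by (auto intro: has_derivative_bounded_linear)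
      show "((\<lambda>x. h x - ?D x0 x) has_derivative (\<lambda>v. ?D z v - ?D x0 v)) (at z within cball x0 r)"
        by (rule has_derivative_at_withinI[OF has_derivative_diff[OF diff[OF z(1)]
            bounded_linear_imp_has_derivative[OF bl(1)]]])
      have lin: "linear (\<lambda>v. ?D z v - ?D x0 v)"
        using bl by (intro bounded_linear.linear bounded_linear_sub)
      have "(\<Sum>b\<in>Basis. \<bar>?D z b - ?D x0 b\<bar>) \<le> e"
        using sum_mono[of Basis "\<lambda>b. \<bar>?D z b - ?D x0 b\<bar>" "\<lambda>_. e / DIM('e)"] z(2) by simp
      then have "\<bar>?D z v - ?D x0 v\<bar> \<le> e * norm v" for v
        using order_trans[OF linear_abs_bound[OF lin] mult_right_mono] norm_ge_zero by blast
      then show "onorm (\<lambda>v. ?D z v - ?D x0 v) \<le> e"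
        by (intro onorm_le) simp
    qed
    then show "\<bar>h x - h y - ?D x0 (x - y)\<bar> \<le> e * norm (x - y)"
      using linear_diff[OF has_derivative_linear[OF diff[OF \<open>x0 \<in> S\<close>]], of x y]
      by (simp add: algebra_simps)
  qed
qed

lemma Ck_on_1_Lipschitz:
  fixes h :: "'e::euclidean_space \<Rightarrow> real"
  assumes "Ck_on (Suc 0) S h" "open S" "x0 \<in> S"
  shows "\<exists>L\<ge>0. \<forall>\<^sub>F r in at_right 0. \<forall>x\<in>cball x0 r. \<forall>y\<in>cball x0 r. \<bar>h x - h y\<bar> \<le> L * norm (x - y)"
proof -
  let ?A = "frechet_derivative h (at x0)"
  have lin: "linear ?A"
    using assms by (intro linear_frechet_derivative) auto
  let ?L = "(\<Sum>b\<in>Basis. \<bar>?A b\<bar>) + 1"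
  have "\<forall>\<^sub>F r in at_right 0. \<forall>x\<in>cball x0 r. \<forall>y\<in>cball x0 r. \<bar>h x - h y\<bar> \<le> ?L * norm (x - y)"
    using Ck_on_1_strict_derivative[OF assms zero_less_one]
  proof (rule eventually_mono, intro ballI)
    fix r x y
    assume "\<forall>x\<in>cball x0 r. \<forall>y\<in>cball x0 r. \<bar>h x - h y - ?A (x - y)\<bar> \<le> 1 * norm (x - y)"
      and "x \<in> cball x0 r" "y \<in> cball x0 r"
    then have "\<bar>h x - h y - ?A (x - y)\<bar> \<le> norm (x - y)" by auto
    then show "\<bar>h x - h y\<bar> \<le> ?L * norm (x - y)"
      using linear_abs_bound[OF lin, of "x - y"] by (simp add: distrib_right)
  qed
  moreover have "?L \<ge> 0" by (simp add: sum_nonneg)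
  ultimately show ?thesis by blast
qed

section \<open>Gradient fields in coordinates\<close>

text \<open>A gradient in coordinates: \<open>G\<close> is the metric and \<open>F\<close> the gradient of \<open>\<phi>\<close>. The vector field \<open>F\<close> is
given through its defining equation, and the estimates below are read off from differences of that
equation at two points.\<close>

locale local_gradient =
  fixes V :: "'e::euclidean_space set" and G :: "'e \<Rightarrow> 'e \<Rightarrow> 'e \<Rightarrow> real"
    and \<phi> :: "'e \<Rightarrow> real" and F :: "'e \<Rightarrow> 'e"
  assumes open_V: "open V"
    and bilinear: "x \<in> V \<Longrightarrow> bilinear (G x)"
    and pos: "x \<in> V \<Longrightarrow> u \<noteq> 0 \<Longrightarrow> 0 < G x u u"
    and G_C1: "Ck_on (Suc 0) V (\<lambda>x. G x u v)"
    and \<phi>_C2: "Ck_on (Suc (Suc 0)) V \<phi>"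
    and F: "x \<in> V \<Longrightarrow> G x (F x) v = frechet_derivative \<phi> (at x) v"
begin

definition D :: "'e \<Rightarrow> 'e \<Rightarrow> real" where
  "D x = frechet_derivative \<phi> (at x)"

definition H :: "'e \<Rightarrow> 'e \<Rightarrow> 'e \<Rightarrow> real" where
  "H x u v = frechet_derivative (\<lambda>y. D y u) (at x) v"

lemma D: "(\<phi> has_derivative D x) (at x)" if "x \<in> V"
  using \<phi>_C2 that unfolding D_def by (simp add: frechet_derivative_works)

lemma linear_D: "linear (D x)" if "x \<in> V"
  using D[OF that] by (rule has_derivative_linear)

lemma D_C1: "Ck_on (Suc 0) V (\<lambda>x. D x v)"
  using \<phi>_C2 unfolding D_def by simp

lemma H: "((\<lambda>y. D y u) has_derivative H x u) (at x)" if "x \<in> V"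
  using D_C1 that unfolding H_def by (simp add: frechet_derivative_works)

lemma D_basis: "D x v = (\<Sum>b\<in>Basis. (v \<bullet> b) * D x b)" if "x \<in> V"
  by (subst (1) euclidean_representation[symmetric, of v])
    (simp add: linear_sum[OF linear_D[OF that]] linear_scale[OF linear_D[OF that]])

lemma H_basis: "H x v z = (\<Sum>b\<in>Basis. (v \<bullet> b) * H x b z)" if "x \<in> V"
proof -
  have "((\<lambda>y. \<Sum>b\<in>Basis. (v \<bullet> b) * D y b) has_derivative (\<lambda>z. \<Sum>b\<in>Basis. (v \<bullet> b) * H x b z)) (at x)"
    using H[OF that] by (intro has_derivative_sum has_derivative_mult_right)
  then have "((\<lambda>y. D y v) has_derivative (\<lambda>z. \<Sum>b\<in>Basis. (v \<bullet> b) * H x b z)) (at x)"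
    by (rule has_derivative_transform_within_open[OF _ open_V that]) (simp add: D_basis[of _ v])
  then show ?thesis
    using has_derivative_unique[OF H[OF that]] by metis
qed

lemma bilinear_H: "bilinear (H x)" if "x \<in> V"
  unfolding bilinear_def
proof (intro conjI allI)
  show "linear (H x u)" for u
    using H[OF that] by (rule has_derivative_linear)
  show "linear (\<lambda>u. H x u z)" for z
  proof (rule linearI)
    show "H x (u + v) z = H x u z + H x v z" for u v
      using H_basis[OF that, of "u + v" z] H_basis[OF that, of u z] H_basis[OF that, of v z]
      by (simp add: inner_left_distrib distrib_right sum.distrib)
    show "H x (c *\<^sub>R u) z = c *\<^sub>R H x u z" for c u
      using H_basis[OF that, of "c *\<^sub>R u" z] H_basis[OF that, of u z]
      by (simp add: sum_distrib_left mult.assoc)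
  qed
qed

lemma D_strict_derivative:
  assumes "x0 \<in> V" "0 < e"
  shows "\<forall>\<^sub>F r in at_right 0. \<forall>x\<in>cball x0 r. \<forall>y\<in>cball x0 r. \<forall>v.
           \<bar>D x v - D y v - H x0 v (x - y)\<bar> \<le> e * norm (x - y) * norm v"
proof -
  let ?e = "e / DIM('e)"
  have "?e > 0" using \<open>0 < e\<close> by simp
  from Ck_on_1_strict_derivative[OF D_C1 open_V \<open>x0 \<in> V\<close> this]
  have "\<forall>b\<in>Basis. \<forall>\<^sub>F r in at_right 0. \<forall>x\<in>cball x0 r. \<forall>y\<in>cball x0 r.
           \<bar>D x b - D y b - H x0 b (x - y)\<bar> \<le> ?e * norm (x - y)"
    unfolding H_def by blast
  then have "\<forall>\<^sub>F r in at_right 0. \<forall>b\<in>Basis. \<forall>x\<in>cball x0 r. \<forall>y\<in>cball x0 r.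
           \<bar>D x b - D y b - H x0 b (x - y)\<bar> \<le> ?e * norm (x - y)"
    by (rule eventually_ball_finite[OF finite_Basis])
  moreover have "\<forall>\<^sub>F r in at_right 0. \<forall>x\<in>cball x0 r. x \<in> V"
    using open_V \<open>x0 \<in> V\<close> by (intro eventually_all_in_cball eventually_nhds_in_open)
  ultimately show ?thesis
  proof eventually_elim
    case (elim r)
    show ?case
    proof (intro ballI allI)
      fix x y v assume xy: "x \<in> cball x0 r" "y \<in> cball x0 r"
      then have V: "x \<in> V" "y \<in> V" using elim by auto
      have "linear (\<lambda>v. D x v - D y v - H x0 v (x - y))"
        using bilinear_H[OF \<open>x0 \<in> V\<close>] linear_D[OF V(1)] linear_D[OF V(2)]
        by (auto simp: bilinear_def intro!: linear_compose_sub)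
      from linear_abs_bound[OF this, of v]
      have "\<bar>D x v - D y v - H x0 v (x - y)\<bar>
          \<le> (\<Sum>b\<in>Basis. \<bar>D x b - D y b - H x0 b (x - y)\<bar>) * norm v" .
      also have "\<dots> \<le> (\<Sum>b\<in>(Basis::'e set). ?e * norm (x - y)) * norm v"
        using elim(1) xy by (intro mult_right_mono sum_mono) auto
      finally show "\<bar>D x v - D y v - H x0 v (x - y)\<bar> \<le> e * norm (x - y) * norm v"
        by simp
    qed
  qed
qed


text \<open>Schwarz's theorem. The second difference of \<open>\<phi>\<close> along the parallelogram spanned by \<open>\<tau> u\<close> and
\<open>\<tau> v\<close> is symmetric in \<open>u\<close> and \<open>v\<close>, and it is \<open>\<tau>\<^sup>2 H u v + o(\<tau>\<^sup>2)\<close> because \<open>H u\<close> is a strict derivative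
of \<open>\<lambda>x. D x u\<close>.\<close>

lemma H_symmetric:
  assumes "x0 \<in> V"
  shows "H x0 u v = H x0 v u"
proof -
  have second_difference: "\<forall>\<^sub>F \<tau> in at_right 0.
      \<bar>\<phi> (x0 + \<tau> *\<^sub>R u + \<tau> *\<^sub>R v) - \<phi> (x0 + \<tau> *\<^sub>R u) - \<phi> (x0 + \<tau> *\<^sub>R v) + \<phi> x0 - \<tau>\<^sup>2 * H x0 u v\<bar>
      \<le> e * \<tau>\<^sup>2" if "0 < e" for e u v
  proof -
    define N where "N = norm u * norm v + 1"
    have "N > 0" by (simp add: N_def add_nonneg_pos)
    then have "\<forall>\<^sub>F r in at_right 0. \<forall>x\<in>cball x0 r. \<forall>y\<in>cball x0 r. \<forall>w.
        \<bar>D x w - D y w - H x0 w (x - y)\<bar> \<le> (e / N) * norm (x - y) * norm w"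
      using \<open>0 < e\<close> by (intro D_strict_derivative assms) simp
    moreover have "\<forall>\<^sub>F r in at_right 0. \<forall>x\<in>cball x0 r. x \<in> V"
      using open_V assms by (intro eventually_all_in_cball eventually_nhds_in_open)
    ultimately have "\<forall>\<^sub>F r in at_right 0. 0 < r \<and> (\<forall>x\<in>cball x0 r. x \<in> V) \<and>
       (\<forall>x\<in>cball x0 r. \<forall>y\<in>cball x0 r. \<forall>w.
        \<bar>D x w - D y w - H x0 w (x - y)\<bar> \<le> (e / N) * norm (x - y) * norm w)"
      using eventually_at_right_less[of 0] by eventually_elim auto
    from eventually_happens'[OF _ this] obtain r where r: "0 < r" "\<And>x. x \<in> cball x0 r \<Longrightarrow> x \<in> V"
      "\<And>x y w. x \<in> cball x0 r \<Longrightarrow> y \<in> cball x0 r \<Longrightarrow>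
        \<bar>D x w - D y w - H x0 w (x - y)\<bar> \<le> (e / N) * norm (x - y) * norm w"
      by auto
    have "\<forall>\<^sub>F \<tau> in at_right 0. \<tau> < r / (norm u + norm v + 1)"
      using \<open>0 < r\<close> unfolding eventually_at_right_field
      by (intro exI[of _ "r / (norm u + norm v + 1)"]) (auto simp: add_nonneg_pos)
    then show ?thesis
      using eventually_at_right_less[of 0]
    proof eventually_elim
      case (elim \<tau>)
      have \<tau>: "\<tau> * (norm u + norm v + 1) < r"
        using elim(1) by (subst (asm) pos_less_divide_eq) (auto simp: add_nonneg_pos)
      have in_ball: "x0 + s *\<^sub>R u + s' *\<^sub>R v \<in> cball x0 r" if "s \<in> {0..\<tau>}" "s' \<in> {0..\<tau>}" for s s'
      proof -
        have "norm (s *\<^sub>R u + s' *\<^sub>R v) \<le> \<tau> * norm u + \<tau> * norm v"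
          using that by (intro norm_triangle_le add_mono) (auto intro!: mult_right_mono)
        then have "norm (s *\<^sub>R u + s' *\<^sub>R v) \<le> r"
          using \<tau> elim(2) by (simp add: distrib_left)
        moreover have "dist x0 (x0 + s *\<^sub>R u + s' *\<^sub>R v) = norm (s *\<^sub>R u + s' *\<^sub>R v)"
          by (metis add.assoc add_diff_cancel_left' dist_norm norm_minus_commute)
        ultimately show ?thesis by simp
      qed
      \<comment> \<open>\<open>k \<tau> - k 0\<close> is the second difference minus its main term, and \<open>k\<close> has small derivative.\<close>
      define k where "k s = \<phi> (x0 + s *\<^sub>R u + \<tau> *\<^sub>R v) - \<phi> (x0 + s *\<^sub>R u) - s * (\<tau> * H x0 u v)" for s
      define k' where "k' s = D (x0 + s *\<^sub>R u + \<tau> *\<^sub>R v) u - D (x0 + s *\<^sub>R u) u - \<tau> * H x0 u v" for s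
      have "norm (k \<tau> - k 0) \<le> (e * \<tau>) * \<bar>\<tau> - 0\<bar>"
      proof (rule norm_diff_le_speed[where S = "{0..\<tau>}" and x' = k'])
        fix s assume s: "s \<in> {0..\<tau>}"
        have V: "x0 + s *\<^sub>R u + \<tau> *\<^sub>R v \<in> cball x0 r" "x0 + s *\<^sub>R u \<in> cball x0 r"
          using in_ball[OF s, of \<tau>] in_ball[OF s, of 0] elim(2) by auto
        have line: "((\<lambda>s. \<phi> (x0 + s *\<^sub>R u + c)) has_real_derivative D (x0 + s *\<^sub>R u + c) u) (at s)"
          if "x0 + s *\<^sub>R u + c \<in> cball x0 r" for c
        proof -
          have "((\<lambda>s. x0 + s *\<^sub>R u + c) has_derivative (\<lambda>a. a *\<^sub>R u)) (at s)"
            by (auto intro!: derivative_eq_intros)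
          note comp = has_derivative_compose[OF this D[OF r(2)[OF that]]]
          have "(\<lambda>a. D (x0 + s *\<^sub>R u + c) (a *\<^sub>R u)) = (*) (D (x0 + s *\<^sub>R u + c) u)"
            by (simp add: fun_eq_iff linear_scale[OF linear_D[OF r(2)[OF that]]])
          with comp show ?thesis
            unfolding has_field_derivative_def by simp
        qed
        have "(k has_real_derivative k' s) (at s)"
          unfolding k_def k'_def
          using line[of "\<tau> *\<^sub>R v"] line[of 0] V
          by (auto intro!: derivative_eq_intros)
        then show "(k has_vector_derivative k' s) (at s within {0..\<tau>})"
          using has_real_derivative_iff_has_vector_derivative has_vector_derivative_at_within by blast
        have "\<bar>k' s\<bar> \<le> (e / N) * norm (\<tau> *\<^sub>R v) * norm u"
          using r(3)[OF V, of u] linear_scale[of "H x0 u" \<tau> v] bilinear_H[OF assms]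
          by (simp add: k'_def bilinear_def)
        also have "\<dots> = (norm u * norm v) * (e * \<tau> / N)"
          using elim(2) by (simp add: mult_ac)
        also have "\<dots> \<le> N * (e * \<tau> / N)"
          using \<open>N > 0\<close> \<open>0 < e\<close> elim(2) by (intro mult_right_mono) (auto simp: N_def)
        finally show "norm (k' s) \<le> e * \<tau>"
          using \<open>N > 0\<close> by simp
      qed (use elim(2) in auto)
      then show ?case
        using elim(2) by (simp add: k_def power2_eq_square algebra_simps)
    qed
  qed
  have "\<bar>H x0 u v - H x0 v u\<bar> \<le> 0 + e" if "0 < e" for e
  proof -
    have "e / 2 > 0" using that by simp
    from eventually_happens'[OF _ eventually_conj[OF eventually_at_right_less[of 0]
        eventually_conj[OF second_difference[OF this, of u v] second_difference[OF this, of v u]]]]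
    obtain \<tau> where "0 < \<tau>"
      "\<bar>\<phi> (x0 + \<tau> *\<^sub>R u + \<tau> *\<^sub>R v) - \<phi> (x0 + \<tau> *\<^sub>R u) - \<phi> (x0 + \<tau> *\<^sub>R v) + \<phi> x0 - \<tau>\<^sup>2 * H x0 u v\<bar> \<le> e/2 * \<tau>\<^sup>2"
      "\<bar>\<phi> (x0 + \<tau> *\<^sub>R u + \<tau> *\<^sub>R v) - \<phi> (x0 + \<tau> *\<^sub>R v) - \<phi> (x0 + \<tau> *\<^sub>R u) + \<phi> x0 - \<tau>\<^sup>2 * H x0 v u\<bar> \<le> e/2 * \<tau>\<^sup>2"
      by (auto simp: add.commute add.left_commute)
    then have "\<bar>\<tau>\<^sup>2 * H x0 u v - \<tau>\<^sup>2 * H x0 v u\<bar> \<le> e * \<tau>\<^sup>2"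
      by linarith
    also have "\<bar>\<tau>\<^sup>2 * H x0 u v - \<tau>\<^sup>2 * H x0 v u\<bar> = \<tau>\<^sup>2 * \<bar>H x0 u v - H x0 v u\<bar>"
      unfolding right_diff_distrib[symmetric] by (simp add: abs_mult)
    finally have "\<tau>\<^sup>2 * \<bar>H x0 u v - H x0 v u\<bar> \<le> \<tau>\<^sup>2 * e"
      by (simp add: mult.commute)
    then show ?thesis using \<open>0 < \<tau>\<close> by simp
  qed
  then have "\<bar>H x0 u v - H x0 v u\<bar> \<le> 0"
    by (rule field_le_epsilon)
  then show ?thesis by simp
qed

lemma metric_Lipschitz:
  assumes "x0 \<in> V"
  shows "\<exists>L\<ge>0. \<forall>\<^sub>F r in at_right 0. \<forall>x\<in>cball x0 r. \<forall>y\<in>cball x0 r. \<forall>u v.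
           \<bar>G x u v - G y u v\<bar> \<le> L * norm (x - y) * norm u * norm v"
proof -
  have "\<forall>u v. \<exists>L. 0 \<le> L \<and> (\<forall>\<^sub>F r in at_right 0. \<forall>x\<in>cball x0 r. \<forall>y\<in>cball x0 r.
          \<bar>G x u v - G y u v\<bar> \<le> L * norm (x - y))"
    using Ck_on_1_Lipschitz[OF G_C1 open_V assms] by blast
  then have "\<exists>L. \<forall>u v. 0 \<le> L u v \<and> (\<forall>\<^sub>F r in at_right 0. \<forall>x\<in>cball x0 r. \<forall>y\<in>cball x0 r.
          \<bar>G x u v - G y u v\<bar> \<le> L u v * norm (x - y))"
    by (simp only: choice_iff)
  then obtain L where L: "\<And>u v. 0 \<le> L u v"
    "\<And>u v. \<forall>\<^sub>F r in at_right 0. \<forall>x\<in>cball x0 r. \<forall>y\<in>cball x0 r. \<bar>G x u v - G y u v\<bar> \<le> L u v * norm (x - y)"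
    by blast
  have "\<forall>\<^sub>F r in at_right 0. \<forall>b\<in>Basis. \<forall>b'\<in>Basis. \<forall>x\<in>cball x0 r. \<forall>y\<in>cball x0 r.
      \<bar>G x b b' - G y b b'\<bar> \<le> L b b' * norm (x - y)"
    by (intro eventually_ball_finite[OF finite_Basis] ballI L(2))
  moreover have "\<forall>\<^sub>F r in at_right 0. \<forall>x\<in>cball x0 r. x \<in> V"
    using open_V assms by (intro eventually_all_in_cball eventually_nhds_in_open)
  ultimately have "\<forall>\<^sub>F r in at_right 0. \<forall>x\<in>cball x0 r. \<forall>y\<in>cball x0 r. \<forall>u v.
           \<bar>G x u v - G y u v\<bar> \<le> (\<Sum>b\<in>Basis. \<Sum>b'\<in>Basis. L b b') * norm (x - y) * norm u * norm v"
  proof eventually_elim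
    case (elim r)
    show ?case
    proof (intro ballI allI)
      fix x y u v assume xy: "x \<in> cball x0 r" "y \<in> cball x0 r"
      then have V: "x \<in> V" "y \<in> V" using elim by auto
      have "bilinear (\<lambda>u v. G x u v - G y u v)"
        using bilinear[OF V(1)] bilinear[OF V(2)] by (auto simp: bilinear_def intro!: linear_compose_sub)
      from bilinear_abs_bound[OF this, of u v]
      have "\<bar>G x u v - G y u v\<bar> \<le> (\<Sum>b\<in>Basis. \<Sum>b'\<in>Basis. \<bar>G x b b' - G y b b'\<bar>) * norm u * norm v" .
      also have "\<dots> \<le> (\<Sum>b\<in>Basis. \<Sum>b'\<in>Basis. L b b' * norm (x - y)) * norm u * norm v"
        using elim(1) xy by (intro mult_right_mono sum_mono) auto
      finally show "\<bar>G x u v - G y u v\<bar> \<le> (\<Sum>b\<in>Basis. \<Sum>b'\<in>Basis. L b b') * norm (x - y) * norm u * norm v"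
        by (simp add: sum_distrib_right[symmetric])
    qed
  qed
  moreover have "0 \<le> (\<Sum>b\<in>Basis. \<Sum>b'\<in>Basis. L b b')"
    using L(1) by (intro sum_nonneg)
  ultimately show ?thesis by blast
qed

text \<open>At \<open>x0\<close> the minimum of the metric on the unit sphere is positive, by compactness; nearby the metric
changes by little.\<close>

lemma metric_coercive:
  assumes "x0 \<in> V"
  shows "\<exists>m>0. \<exists>C>0. \<forall>\<^sub>F r in at_right 0. \<forall>x\<in>cball x0 r. \<forall>u v.
           m * (norm u)\<^sup>2 \<le> G x u u \<and> \<bar>G x u v\<bar> \<le> C * norm u * norm v"
proof -
  obtain L where L: "0 \<le> L" "\<forall>\<^sub>F r in at_right 0. \<forall>x\<in>cball x0 r. \<forall>y\<in>cball x0 r. \<forall>u v.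
           \<bar>G x u v - G y u v\<bar> \<le> L * norm (x - y) * norm u * norm v"
    using metric_Lipschitz[OF assms] by blast
  define C0 where "C0 = (\<Sum>b\<in>Basis. \<Sum>b'\<in>Basis. \<bar>G x0 b b'\<bar>)"
  have C0: "\<bar>G x0 u v\<bar> \<le> C0 * norm u * norm v" for u v
    unfolding C0_def by (rule bilinear_abs_bound[OF bilinear[OF assms]])
  have "C0 \<ge> 0" by (simp add: C0_def sum_nonneg)
  obtain m where m: "m > 0" "\<And>u. m * (norm u)\<^sup>2 \<le> G x0 u u"
  proof -
    have "continuous_on (sphere 0 1) (\<lambda>u. G x0 u u)"
      using bilinear[OF assms] by (intro bounded_bilinear.continuous_on[where prod = "G x0"])
        (auto simp: bilinear_conv_bounded_bilinear)
    from continuous_attains_inf[OF compact_sphere _ this] obtain w where w: "w \<in> sphere 0 1" "\<And>u. u \<in> sphere 0 1 \<Longrightarrow> G x0 w w \<le> G x0 u u"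
      by auto
    show ?thesis
    proof
      show "0 < G x0 w w" using w(1) by (intro pos assms) auto
      fix u show "G x0 w w * (norm u)\<^sup>2 \<le> G x0 u u"
      proof (cases "u = 0")
        case True
        then show ?thesis using bilinear_lzero[OF bilinear[OF assms]] by simp
      next
        case False
        have "G x0 w w \<le> G x0 (u /\<^sub>R norm u) (u /\<^sub>R norm u)"
          using False by (intro w(2)) simp
        also have "\<dots> = G x0 u u / (norm u)\<^sup>2"
          using bilinear[OF assms]
          by (simp add: bilinear_lmul bilinear_rmul power2_eq_square divide_inverse mult_ac)
        finally show ?thesis using False by (simp add: field_simps)
      qed
    qed
  qed
  have "\<forall>\<^sub>F r in at_right 0. r < min 1 (m / (2 * (L + 1)))"
    using \<open>m > 0\<close> \<open>0 \<le> L\<close> unfolding eventually_at_right_field by (intro exI[of _ "min 1 (m / (2 * (L + 1)))"]) auto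
  with L(2) have "\<forall>\<^sub>F r in at_right 0. \<forall>x\<in>cball x0 r. \<forall>u v.
           (m/2) * (norm u)\<^sup>2 \<le> G x u u \<and> \<bar>G x u v\<bar> \<le> (C0 + L + 1) * norm u * norm v"
    using eventually_at_right_less[of 0]
  proof eventually_elim
    case (elim r)
    show ?case
    proof (intro ballI allI)
      fix x u v :: 'e assume x: "x \<in> cball x0 r"
      have r: "L * r \<le> L" "L * r \<le> m / 2"
      proof -
        show "L * r \<le> L" using elim \<open>0 \<le> L\<close> by (simp add: mult_left_le)
        have "(L + 1) * r < m / 2"
          using elim \<open>0 \<le> L\<close> by (simp add: field_simps)
        then show "L * r \<le> m / 2" using elim(3) by (simp add: distrib_right)
      qed
      have near: "\<bar>G x u v - G x0 u v\<bar> \<le> (L * r) * norm u * norm v" for u v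
      proof -
        have "\<bar>G x u v - G x0 u v\<bar> \<le> L * norm (x - x0) * norm u * norm v"
          using elim(1) x elim(3) by auto
        also have "\<dots> \<le> (L * r) * norm u * norm v"
          using x \<open>0 \<le> L\<close> by (intro mult_right_mono mult_left_mono) (auto simp: dist_norm norm_minus_commute)
        finally show ?thesis .
      qed
      have "(L * r) * norm u * norm u \<le> (m / 2) * norm u * norm u"
        using r(2) by (intro mult_right_mono) auto
      then have "(m/2) * (norm u)\<^sup>2 \<le> G x u u"
        using near[of u u] m(2)[of u] by (simp add: power2_eq_square)
      moreover have "(L * r) * norm u * norm v \<le> (L + 1) * norm u * norm v"
        using r(1) by (intro mult_right_mono) auto
      then have "\<bar>G x u v\<bar> \<le> (C0 + L + 1) * norm u * norm v"
        using near[of u v] C0[of u v] by (simp add: algebra_simps)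
      ultimately show "(m/2) * (norm u)\<^sup>2 \<le> G x u u \<and> \<bar>G x u v\<bar> \<le> (C0 + L + 1) * norm u * norm v" ..
    qed
  qed
  moreover have "m / 2 > 0" "C0 + L + 1 > 0"
    using \<open>m > 0\<close> \<open>0 \<le> L\<close> \<open>C0 \<ge> 0\<close> by auto
  ultimately show ?thesis by blast
qed

text \<open>Subtracting the equations for \<open>F x\<close> and \<open>F y\<close> gives
\<open>G x (F x - F y) v = (D x v - D y v) - (G x (F y) v - G y (F y) v)\<close>, whose right-hand side is
\<open>O(\<bar>x - y\<bar> \<bar>v\<bar>)\<close>; taking \<open>v = F x - F y\<close>, coercivity of \<open>G\<close> yields the claim.\<close>

lemma gradient_Lipschitz:
  assumes "x0 \<in> V"
  shows "\<exists>K\<ge>0. \<exists>L\<ge>0. \<forall>\<^sub>F r in at_right 0. \<forall>x\<in>cball x0 r. norm (F x) \<le> K \<and>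
           (\<forall>y\<in>cball x0 r. norm (F x - F y) \<le> L * norm (x - y))"
proof -
  obtain m C where m: "m > 0" "C > 0" "\<forall>\<^sub>F r in at_right 0. \<forall>x\<in>cball x0 r. \<forall>u v.
           m * (norm u)\<^sup>2 \<le> G x u u \<and> \<bar>G x u v\<bar> \<le> C * norm u * norm v"
    using metric_coercive[OF assms] by blast
  obtain Lg where Lg: "0 \<le> Lg" "\<forall>\<^sub>F r in at_right 0. \<forall>x\<in>cball x0 r. \<forall>y\<in>cball x0 r. \<forall>u v.
           \<bar>G x u v - G y u v\<bar> \<le> Lg * norm (x - y) * norm u * norm v"
    using metric_Lipschitz[OF assms] by blast
  define h where "h = (\<Sum>b\<in>Basis. \<Sum>b'\<in>Basis. \<bar>H x0 b b'\<bar>)"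
  define d where "d = (\<Sum>b\<in>Basis. \<bar>D x0 b\<bar>)"
  define K where "K = (d + h + 1) / m"
  define L where "L = (h + 1 + Lg * K) / m"
  have "h \<ge> 0" "d \<ge> 0" by (auto simp: h_def d_def intro!: sum_nonneg)
  then have "K \<ge> 0" "L \<ge> 0"
    using \<open>m > 0\<close> \<open>Lg \<ge> 0\<close> by (auto simp: K_def L_def)
  have small: "\<forall>\<^sub>F r in at_right 0. r < (1::real)"
    unfolding eventually_at_right_field by (intro exI[of _ 1]) auto
  have inV: "\<forall>\<^sub>F r in at_right 0. \<forall>x\<in>cball x0 r. x \<in> V"
    using open_V assms by (intro eventually_all_in_cball eventually_nhds_in_open)
  have "\<forall>\<^sub>F r in at_right 0. \<forall>x\<in>cball x0 r. norm (F x) \<le> K \<and>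
           (\<forall>y\<in>cball x0 r. norm (F x - F y) \<le> L * norm (x - y))"
    using m(3) Lg(2) D_strict_derivative[OF assms zero_less_one] small inV eventually_at_right_less[of 0]
  proof eventually_elim
    case (elim r)
    have D_diff: "\<bar>D x v - D y v\<bar> \<le> (h + 1) * norm (x - y) * norm v"
      if "x \<in> cball x0 r" "y \<in> cball x0 r" for x y v
    proof -
      have "\<bar>H x0 v (x - y)\<bar> \<le> h * norm v * norm (x - y)"
        unfolding h_def by (rule bilinear_abs_bound[OF bilinear_H[OF assms]])
      moreover have "\<bar>D x v - D y v - H x0 v (x - y)\<bar> \<le> norm (x - y) * norm v"
        using elim(3) that by auto
      ultimately show ?thesis by (simp add: algebra_simps)
    qed
    have bound: "norm (F x) \<le> K" if x: "x \<in> cball x0 r" for x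
    proof -
      have "x0 \<in> cball x0 r" using elim by simp
      from D_diff[OF x this, of "F x"]
      have "\<bar>D x (F x) - D x0 (F x)\<bar> \<le> (h + 1) * norm (x - x0) * norm (F x)" .
      also have "\<dots> \<le> (h + 1) * 1 * norm (F x)"
        using x elim(4) \<open>h \<ge> 0\<close> by (intro mult_right_mono mult_left_mono) (auto simp: dist_norm norm_minus_commute)
      finally have "D x (F x) \<le> (d + h + 1) * norm (F x)"
        using linear_abs_bound[OF linear_D[OF assms], of "F x"] by (simp add: d_def algebra_simps)
      moreover have "m * (norm (F x))\<^sup>2 \<le> D x (F x)"
      proof -
        have "m * (norm (F x))\<^sup>2 \<le> G x (F x) (F x)" using elim(1) x by blast
        moreover have "x \<in> V" using elim(5) x by blast
        ultimately show ?thesis using F[of x "F x"] by (simp add: D_def)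
      qed
      ultimately have "(m * norm (F x)) * norm (F x) \<le> (d + h + 1) * norm (F x)"
        by (simp add: power2_eq_square mult.assoc)
      then have "m * norm (F x) \<le> d + h + 1"
        using \<open>h \<ge> 0\<close> \<open>d \<ge> 0\<close> by (cases "F x = 0") auto
      then show ?thesis using \<open>m > 0\<close> by (simp add: K_def pos_le_divide_eq mult.commute)
    qed
    have "norm (F x - F y) \<le> L * norm (x - y)" if x: "x \<in> cball x0 r" and y: "y \<in> cball x0 r" for x y
    proof -
      let ?u = "F x - F y"
      have V: "x \<in> V" "y \<in> V" using elim x y by auto
      have eq: "G x ?u ?u = (D x ?u - D y ?u) - (G x (F y) ?u - G y (F y) ?u)"
        using F[OF V(1), of ?u] F[OF V(2), of ?u] bilinear_lsub[OF bilinear[OF V(1)], of "F x" "F y" ?u]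
        by (simp add: D_def)
      have "\<bar>G x (F y) ?u - G y (F y) ?u\<bar> \<le> Lg * norm (x - y) * norm (F y) * norm ?u"
        using elim(2) x y by blast
      also have "\<dots> \<le> Lg * norm (x - y) * K * norm ?u"
        using bound[OF y] \<open>Lg \<ge> 0\<close> by (intro mult_right_mono mult_left_mono) auto
      finally have "G x ?u ?u \<le> (h + 1) * norm (x - y) * norm ?u + Lg * norm (x - y) * K * norm ?u"
        using D_diff[OF x y, of ?u] unfolding eq by linarith
      moreover have "m * (norm ?u)\<^sup>2 \<le> G x ?u ?u"
        using elim(1) x by blast
      ultimately have "(m * norm ?u) * norm ?u \<le> ((h + 1 + Lg * K) * norm (x - y)) * norm ?u"
        by (simp add: power2_eq_square algebra_simps)
      then have "m * norm ?u \<le> (h + 1 + Lg * K) * norm (x - y)"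
        using \<open>h \<ge> 0\<close> \<open>K \<ge> 0\<close> \<open>Lg \<ge> 0\<close> by (cases "?u = 0") auto
      then show ?thesis using \<open>m > 0\<close> by (simp add: L_def pos_le_divide_eq mult.commute)
    qed
    then show ?case using bound by blast
  qed
  then show ?thesis using \<open>K \<ge> 0\<close> \<open>L \<ge> 0\<close> by blast
qed

text \<open>Near a critical point \<open>F\<close> is small, so with \<open>u = F x - F y\<close> and \<open>z = x - y\<close> the difference of the
equations for \<open>F x\<close> and \<open>F y\<close> reads \<open>G x u v = H x0 v z + o(\<bar>z\<bar> \<bar>v\<bar>)\<close>. With \<open>v = u\<close> this bounds
\<open>H x0 u z\<close> from below by \<open>m \<bar>u\<bar>\<^sup>2\<close> up to the error. With \<open>v\<close> the vector that represents
\<open>\<lambda>v. H x0 v z\<close> it gives \<open>\<bar>u\<bar> \<ge> const \<bar>z\<bar>\<close>, because the Hessian is non-degenerate. In particular two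
zeros of \<open>F\<close> near \<open>x0\<close> coincide.\<close>

lemma hessian_expands:
  assumes "x0 \<in> V" and critical: "\<And>v. D x0 v = 0"
    and nondegenerate: "\<And>u. (\<And>v. H x0 u v = 0) \<Longrightarrow> u = 0"
  shows "\<exists>c>0. \<forall>\<^sub>F r in at_right 0. \<forall>x\<in>cball x0 r. \<forall>y\<in>cball x0 r.
           c * (norm (x - y))\<^sup>2 \<le> H x0 (F x - F y) (x - y)"
proof -
  obtain m C where m: "m > 0" "C > 0" "\<forall>\<^sub>F r in at_right 0. \<forall>x\<in>cball x0 r. \<forall>u v.
           m * (norm u)\<^sup>2 \<le> G x u u \<and> \<bar>G x u v\<bar> \<le> C * norm u * norm v"
    using metric_coercive[OF assms(1)] by blast
  obtain Lg where Lg: "0 \<le> Lg" "\<forall>\<^sub>F r in at_right 0. \<forall>x\<in>cball x0 r. \<forall>y\<in>cball x0 r. \<forall>u v.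
           \<bar>G x u v - G y u v\<bar> \<le> Lg * norm (x - y) * norm u * norm v"
    using metric_Lipschitz[OF assms(1)] by blast
  obtain K L where L: "0 \<le> L" "\<forall>\<^sub>F r in at_right 0. \<forall>x\<in>cball x0 r. norm (F x) \<le> K \<and>
           (\<forall>y\<in>cball x0 r. norm (F x - F y) \<le> L * norm (x - y))"
    using gradient_Lipschitz[OF assms(1)] by blast
  have bilH: "bilinear (H x0)" by (rule bilinear_H[OF assms(1)])
  \<comment> \<open>\<open>T\<close> is the Hessian as an endomorphism; being injective it is bounded below by some \<open>\<mu>\<close>.\<close>
  define T where "T z = (\<Sum>b\<in>Basis. H x0 b z *\<^sub>R b)" for z
  have HT: "H x0 v z = T z \<bullet> v" for v z
    using H_basis[OF assms(1), of v z] by (simp add: T_def inner_sum_left inner_commute[of v] mult.commute)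
  have "linear T"
    using bilH unfolding T_def
    by (intro linearI) (simp_all add: bilinear_radd bilinear_rmul scaleR_left_distrib sum.distrib scaleR_sum_right)
  moreover have "inj T"
    unfolding linear_injective_0[OF \<open>linear T\<close>]
    using HT H_symmetric[OF assms(1)] nondegenerate by (metis inner_zero_left)
  ultimately obtain \<mu> where \<mu>: "\<mu> > 0" "\<And>z. \<mu> * norm z \<le> norm (T z)"
    using linear_inj_bounded_below_pos by blast
  \<comment> \<open>The error \<open>e\<close> has to be below half of \<open>\<mu>\<close> to give \<open>\<mu> / (2 C) * \<bar>z\<bar> \<le> \<bar>u\<bar>\<close>, and then below
      half of \<open>m * \<mu> / (2 C)\<close> to be absorbed by \<open>m \<bar>u\<bar>\<close>.\<close>
  define e where "e = min (\<mu> / 2) (m * \<mu> / (4 * C))"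
  have e: "0 < e" "e \<le> \<mu> / 2" "e \<le> m * \<mu> / (4 * C)"
    using m \<mu> by (auto simp: e_def)
  define c where "c = (\<mu> / (2 * C)) * (m * \<mu> / (4 * C))"
  have "c > 0" using m \<mu> by (simp add: c_def)
  define N where "N = Lg * L + 1"
  have "N > 0" using Lg(1) L(1) by (simp add: N_def add_nonneg_pos)
  \<comment> \<open>Within this radius \<open>F\<close> is so small that the variation of the metric contributes at most \<open>e / 2\<close>.\<close>
  define r0 where "r0 = e / (2 * N)"
  have "r0 > 0" using e \<open>N > 0\<close> by (simp add: r0_def)
  have r0: "Lg * L * r0 \<le> e / 2"
  proof -
    have "N * r0 = e / 2" using \<open>N > 0\<close> by (simp add: r0_def)
    then show ?thesis using \<open>r0 > 0\<close> by (simp add: N_def distrib_right)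
  qed
  have small: "\<forall>\<^sub>F r in at_right 0. r < r0"
    using \<open>r0 > 0\<close> unfolding eventually_at_right_field by (intro exI[of _ r0]) auto
  have inV: "\<forall>\<^sub>F r in at_right 0. \<forall>x\<in>cball x0 r. x \<in> V"
    using open_V assms by (intro eventually_all_in_cball eventually_nhds_in_open)
  have "e / 2 > 0" using e by simp
  from m(3) Lg(2) L(2) D_strict_derivative[OF assms(1) this] small inV eventually_at_right_less[of 0]
  have "\<forall>\<^sub>F r in at_right 0. \<forall>x\<in>cball x0 r. \<forall>y\<in>cball x0 r.
           c * (norm (x - y))\<^sup>2 \<le> H x0 (F x - F y) (x - y)"
  proof eventually_elim
    case (elim r)
    have x0: "x0 \<in> cball x0 r" using elim by simp
    have "G x0 (F x0) (F x0) = 0"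
      using F[OF assms(1)] critical by (simp add: D_def)
    then have "F x0 = 0" using pos[OF assms(1), of "F x0"] by fastforce
    show ?case
    proof (intro ballI)
      fix x y assume x: "x \<in> cball x0 r" and y: "y \<in> cball x0 r"
      have V: "x \<in> V" "y \<in> V" using elim x y by auto
      define u where "u = F x - F y"
      define z where "z = x - y"
      have HG: "\<bar>H x0 v z - G x u v\<bar> \<le> e * norm z * norm v" for v
      proof -
        have "norm (F y) \<le> L * norm (y - x0)"
          using elim(3) y x0 \<open>F x0 = 0\<close> by (metis diff_zero)
        also have "\<dots> \<le> L * r0"
          using y elim(5) \<open>0 \<le> L\<close> by (intro mult_left_mono) (auto simp: dist_norm norm_minus_commute)
        finally have Fy: "norm (F y) \<le> L * r0" .
        have "\<bar>G x (F y) v - G y (F y) v\<bar> \<le> Lg * norm z * norm (F y) * norm v"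
          using elim(2) x y unfolding z_def by blast
        also have "\<dots> \<le> Lg * norm z * (L * r0) * norm v"
          using Fy \<open>Lg \<ge> 0\<close> by (intro mult_right_mono mult_left_mono) auto
        also have "\<dots> = (Lg * L * r0) * (norm z * norm v)"
          by (simp add: mult_ac)
        also have "\<dots> \<le> (e / 2) * (norm z * norm v)"
          using r0 by (intro mult_right_mono) auto
        finally have "\<bar>G x (F y) v - G y (F y) v\<bar> \<le> e / 2 * norm z * norm v"
          by (simp add: mult_ac)
        moreover have "\<bar>D x v - D y v - H x0 v z\<bar> \<le> e / 2 * norm z * norm v"
          using elim(4) x y unfolding z_def by blast
        moreover have "G x u v = (D x v - D y v) - (G x (F y) v - G y (F y) v)"
          using F[OF V(1), of v] F[OF V(2), of v] bilinear_lsub[OF bilinear[OF V(1)], of "F x" "F y" v]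
          by (simp add: D_def u_def)
        ultimately show ?thesis by linarith
      qed
      have "(\<mu> - e) * norm z \<le> C * norm u"
      proof -
        have "(norm (T z))\<^sup>2 = H x0 (T z) z"
          by (simp add: HT power2_norm_eq_inner)
        also have "\<dots> \<le> C * norm u * norm (T z) + e * norm z * norm (T z)"
          using HG[of "T z"] elim(1) x by (smt (verit))
        finally have "norm (T z) * norm (T z) \<le> (C * norm u + e * norm z) * norm (T z)"
          by (simp add: power2_eq_square algebra_simps)
        then have "norm (T z) \<le> C * norm u + e * norm z"
          using m(2) e(1) by (cases "T z = 0") auto
        then show ?thesis using \<mu>(2)[of z] by (simp add: algebra_simps)
      qed
      moreover have "(\<mu> / 2) * norm z \<le> (\<mu> - e) * norm z"
        using e by (intro mult_right_mono) auto
      ultimately have "(\<mu> / 2) * norm z \<le> C * norm u" by linarith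
      then have u: "(\<mu> / (2 * C)) * norm z \<le> norm u"
        using m(2) by (simp add: field_simps)
      have "(m * \<mu> / (4 * C)) * norm z = m * ((\<mu> / (2 * C)) * norm z) - (m * \<mu> / (4 * C)) * norm z"
        by (simp add: field_simps)
      also have "\<dots> \<le> m * norm u - e * norm z"
        using u e(3) m(1) by (intro diff_mono mult_left_mono mult_right_mono) auto
      finally have m_e: "(m * \<mu> / (4 * C)) * norm z \<le> m * norm u - e * norm z" .
      have "c * (norm z)\<^sup>2 = ((\<mu> / (2 * C)) * norm z) * ((m * \<mu> / (4 * C)) * norm z)"
        by (simp add: c_def power2_eq_square)
      also have "\<dots> \<le> norm u * (m * norm u - e * norm z)"
        using u m_e m \<mu> by (intro mult_mono) auto
      also have "\<dots> = m * (norm u)\<^sup>2 - e * norm z * norm u"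
        by (simp add: power2_eq_square algebra_simps)
      also have "\<dots> \<le> G x u u - e * norm z * norm u"
        using elim(1) x by simp
      also have "\<dots> \<le> H x0 u z"
        using HG[of u] by linarith
      finally show "c * (norm (x - y))\<^sup>2 \<le> H x0 (F x - F y) (x - y)"
        by (simp add: u_def z_def)
    qed
  qed
  then show ?thesis using \<open>c > 0\<close> by blast
qed


section \<open>Trapped curves near a non-degenerate critical point\<close>

text \<open>Trapped curves cannot separate along directions in which \<open>H\<close> is negative, since there the
separation would grow forever. So the set of their initial values meets each line parallel to \<open>w\<close>
in at most one point, and it is even a Lipschitz graph over the hyperplane orthogonal to \<open>w\<close>.\<close>

lemma trapped_set_negligible:
  assumes "x0 \<in> V" and critical: "\<And>v. D x0 v = 0"
    and nondegenerate: "\<And>u. (\<And>v. H x0 u v = 0) \<Longrightarrow> u = 0"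
    and "H x0 w w < 0"
  shows "\<forall>\<^sub>F r in at_right 0. \<forall>S. (\<forall>a\<in>S. \<exists>x. x 0 = a \<and> (\<forall>t\<ge>0. x t \<in> cball x0 r \<and>
            (x has_vector_derivative - F (x t)) (at t within {0..}))) \<longrightarrow> negligible S"
proof -
  obtain c where c: "c > 0" "\<forall>\<^sub>F r in at_right 0. \<forall>x\<in>cball x0 r. \<forall>y\<in>cball x0 r.
           c * (norm (x - y))\<^sup>2 \<le> H x0 (F x - F y) (x - y)"
    using hessian_expands[OF assms(1-3)] by blast
  have bil: "bilinear (H x0)" by (rule bilinear_H[OF assms(1)])
  define h where "h = (\<Sum>b\<in>Basis. \<Sum>b'\<in>Basis. \<bar>H x0 b b'\<bar>)"
  have "h \<ge> 0" by (simp add: h_def sum_nonneg)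
  have h: "\<bar>H x0 u v\<bar> \<le> h * norm u * norm v" for u v
    unfolding h_def by (rule bilinear_abs_bound[OF bil])
  from c(2) show ?thesis
  proof (rule eventually_mono, intro allI impI)
    fix r S
    assume expand: "\<forall>x\<in>cball x0 r. \<forall>y\<in>cball x0 r. c * (norm (x - y))\<^sup>2 \<le> H x0 (F x - F y) (x - y)"
      and S: "\<forall>a\<in>S. \<exists>x. x 0 = a \<and> (\<forall>t\<ge>0. x t \<in> cball x0 r \<and>
            (x has_vector_derivative - F (x t)) (at t within {0..}))"
    have cone: "0 \<le> H x0 (a - b) (a - b)" if "a \<in> S" "b \<in> S" for a b
    proof (rule ccontr)
      assume neg: "\<not> 0 \<le> H x0 (a - b) (a - b)"
      obtain x where x: "x 0 = a" "\<And>t. t \<ge> 0 \<Longrightarrow> x t \<in> cball x0 r"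
        "\<And>t. t \<ge> 0 \<Longrightarrow> (x has_vector_derivative - F (x t)) (at t within {0..})"
        using S \<open>a \<in> S\<close> by meson
      obtain y where y: "y 0 = b" "\<And>t. t \<ge> 0 \<Longrightarrow> y t \<in> cball x0 r"
        "\<And>t. t \<ge> 0 \<Longrightarrow> (y has_vector_derivative - F (y t)) (at t within {0..})"
        using S \<open>b \<in> S\<close> by meson
      define z where "z t = x t - y t" for t
      define P where "P t = H x0 (z t) (z t)" for t
      define P' where "P' t = - 2 * H x0 (F (x t) - F (y t)) (z t)" for t
      have P': "(P has_real_derivative P' t) (at t within {0..T})" if "t \<in> {0..T}" for t T
      proof -
        have "(z has_vector_derivative - F (x t) - (- F (y t))) (at t within {0..})"
          unfolding z_def using that x(3) y(3) by (intro has_vector_derivative_diff) auto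
        then have z: "(z has_vector_derivative - (F (x t) - F (y t))) (at t within {0..T})"
          by (rule has_vector_derivative_within_subset[THEN has_vector_derivative_eq_rhs]) auto
        have "bounded_bilinear (H x0)"
          using bil by (simp add: bilinear_conv_bounded_bilinear)
        from bounded_bilinear.has_vector_derivative[OF this z z]
        moreover have "H x0 (z t) (- (F (x t) - F (y t))) + H x0 (- (F (x t) - F (y t))) (z t) = P' t"
          using H_symmetric[OF assms(1), of "z t" "F (x t) - F (y t)"]
          unfolding P'_def bilinear_lneg[OF bil] bilinear_rneg[OF bil] by linarith
        ultimately have "(P has_vector_derivative P' t) (at t within {0..T})"
          unfolding P_def by (rule has_vector_derivative_eq_rhs)
        then show ?thesis
          by (simp add: has_real_derivative_iff_has_vector_derivative)
      qed
      have P'_le: "P' t \<le> - (2 * c * (norm (z t))\<^sup>2)" if "t \<ge> 0" for t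
        using expand x(2)[OF that] y(2)[OF that] unfolding P'_def z_def by fastforce
      have P0: "P 0 < 0" using neg by (simp add: P_def z_def x(1) y(1))
      have "h > 0"
        using h[of "z 0" "z 0"] P0 \<open>h \<ge> 0\<close> by (cases "h = 0") (auto simp: P_def)
      have P_dec: "P t \<le> P 0" if "t \<ge> 0" for t
      proof -
        have "P t \<le> P 0 - 0 * (t - 0)"
        proof (rule decrease_at_rate[OF that P'])
          fix s assume "s \<in> {0..t}"
          then show "P' s \<le> - 0"
            using P'_le[of s] \<open>c > 0\<close> by (auto intro: order_trans)
        qed
        then show ?thesis by simp
      qed
      define k where "k = - 2 * c * P 0 / h"
      have "k > 0" using \<open>c > 0\<close> \<open>h > 0\<close> P0 by (simp add: k_def divide_neg_pos mult_pos_neg)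
      have P'_k: "P' t \<le> - k" if "t \<ge> 0" for t
      proof -
        have "- P 0 \<le> h * (norm (z t))\<^sup>2"
          using h[of "z t" "z t"] P_dec[OF that] by (simp add: P_def power2_eq_square mult.assoc)
        then have "- P 0 / h \<le> (norm (z t))\<^sup>2"
          using \<open>h > 0\<close> by (subst pos_divide_le_eq) (simp_all add: mult.commute)
        then have "2 * c * (- P 0 / h) \<le> 2 * c * (norm (z t))\<^sup>2"
          using \<open>c > 0\<close> by (intro mult_left_mono) auto
        then show ?thesis using P'_le[OF that] by (simp add: k_def)
      qed
      \<comment> \<open>By this time \<open>P\<close> has dropped below its lower bound \<open>- h * (2 * r)\<^sup>2\<close>, where \<open>2 * r\<close> is the diameter.\<close>
      define T where "T = h * (2 * r)\<^sup>2 / k"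
      have "T \<ge> 0" using \<open>h > 0\<close> \<open>k > 0\<close> by (simp add: T_def)
      have "P T \<le> P 0 - k * (T - 0)"
        using P'_k by (intro decrease_at_rate[OF \<open>T \<ge> 0\<close> P']) auto
      then have "P T < - (h * (2 * r)\<^sup>2)"
        using P0 \<open>k > 0\<close> by (simp add: T_def)
      moreover have "norm (z T) \<le> 2 * r"
        using dist_triangle3[of "x T" "y T" x0] x(2)[OF \<open>T \<ge> 0\<close>] y(2)[OF \<open>T \<ge> 0\<close>] by (simp add: z_def dist_norm)
      then have "h * (norm (z T))\<^sup>2 \<le> h * (2 * r)\<^sup>2"
        using \<open>h > 0\<close> by (intro mult_left_mono power_mono) auto
      then have "- (h * (2 * r)\<^sup>2) \<le> P T"
        using h[of "z T" "z T"] by (simp add: P_def power2_eq_square mult.assoc)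
      ultimately show False by linarith
    qed
    \<comment> \<open>The projection \<open>k\<close> along the unit vector \<open>e\<close> is expanding on \<open>S\<close>: by \<open>cone\<close> a difference \<open>p + s e\<close>
        satisfies \<open>\<delta> s\<^sup>2 \<le> h \<bar>p\<bar>\<^sup>2 + 2 h \<bar>s\<bar> \<bar>p\<bar>\<close>, which bounds \<open>\<bar>s\<bar>\<close> by a multiple of \<open>\<bar>p\<bar>\<close>.\<close>
    define e where "e = w /\<^sub>R norm w"
    have "w \<noteq> 0" using \<open>H x0 w w < 0\<close> bilinear_lzero[OF bil] by force
    then have "norm e = 1" by (simp add: e_def)
    define \<delta> where "\<delta> = - H x0 e e"
    have "\<delta> > 0"
      using \<open>H x0 w w < 0\<close> \<open>w \<noteq> 0\<close> bil by (simp add: \<delta>_def e_def bilinear_lmul bilinear_rmul zero_less_mult_iff mult_less_0_iff)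
    define k where "k b = b - (b \<bullet> e) *\<^sub>R e" for b
    show "negligible S"
    proof (rule negligible_if_expanding_into_negligible)
      show "negligible {x. e \<bullet> x = 0}"
        using \<open>norm e = 1\<close> by (intro negligible_hyperplane) auto
      show "k b \<in> {x. e \<bullet> x = 0}" for b
        using \<open>norm e = 1\<close> by (simp add: k_def inner_diff_right inner_commute dot_square_norm)
      fix a b assume ab: "a \<in> S" "b \<in> S"
      define d where "d = a - b"
      define s where "s = d \<bullet> e"
      define p where "p = d - s *\<^sub>R e"
      have kp: "k a - k b = p"
        by (simp add: k_def p_def s_def d_def inner_diff_left algebra_simps)
      have "d = p + s *\<^sub>R e" by (simp add: p_def)
      then have "H x0 d d = H x0 p p + 2 * s * H x0 p e + s\<^sup>2 * H x0 e e"
        using bil H_symmetric[OF assms(1), of e p]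
        by (simp add: bilinear_ladd bilinear_radd bilinear_lmul bilinear_rmul power2_eq_square algebra_simps)
      moreover have "2 * s * H x0 p e \<le> 2 * (\<bar>s\<bar> * (h * norm p))"
        using mult_left_mono[OF h[of p e], of "\<bar>s\<bar>"] \<open>norm e = 1\<close> abs_ge_self[of "s * H x0 p e"]
        by (simp add: abs_mult)
      ultimately have quad: "\<delta> * s\<^sup>2 \<le> h * (norm p)\<^sup>2 + 2 * (\<bar>s\<bar> * (h * norm p))"
        using cone[OF ab] h[of p p] unfolding d_def[symmetric]
        by (simp add: \<delta>_def power2_eq_square algebra_simps)
      have "\<bar>s\<bar> \<le> (3 * h / \<delta> + 1) * norm p"
      proof (cases "\<bar>s\<bar> \<le> norm p")
        case True
        moreover have "1 * norm p \<le> (3 * h / \<delta> + 1) * norm p"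
          using \<open>h \<ge> 0\<close> \<open>\<delta> > 0\<close> by (intro mult_right_mono) auto
        ultimately show ?thesis by linarith
      next
        case False
        have "\<bar>s\<bar> * (\<delta> * \<bar>s\<bar>) = \<delta> * s\<^sup>2"
          by (simp add: power2_eq_square)
        also have "h * (norm p)\<^sup>2 \<le> \<bar>s\<bar> * (h * norm p)"
        proof -
          have "norm p * (h * norm p) \<le> \<bar>s\<bar> * (h * norm p)"
            using False \<open>h \<ge> 0\<close> by (intro mult_right_mono) auto
          then show ?thesis by (simp add: power2_eq_square mult_ac)
        qed
        then have "\<delta> * s\<^sup>2 \<le> \<bar>s\<bar> * (3 * h * norm p)"
          using quad by simp
        finally have "\<delta> * \<bar>s\<bar> \<le> 3 * h * norm p"
          using False by (cases "s = 0") (auto simp: mult_le_cancel_left)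
        then have "\<bar>s\<bar> \<le> 3 * h / \<delta> * norm p"
          using \<open>\<delta> > 0\<close> by (simp add: pos_le_divide_eq mult.commute)
        then show ?thesis by (simp add: distrib_right add_increasing2)
      qed
      moreover have "norm d \<le> norm p + \<bar>s\<bar>"
        using norm_triangle_ineq[of p "s *\<^sub>R e"] \<open>norm e = 1\<close> by (simp add: p_def)
      ultimately show "norm (a - b) \<le> (3 * h / \<delta> + 1 + 1) * norm (k a - k b)"
        unfolding kp d_def[symmetric] by (simp add: algebra_simps)
    qed
  qed
qed

end

section \<open>Tensors and changes of charts\<close>

locale compact_morse =
  fixes M :: "'m::t2_space set"
    and A :: "('m, 'e::euclidean_space) chart set"
    and g :: "('m, 'e) metric_field"
    and f :: "'m \<Rightarrow> real"
  assumes manifold: "smooth_manifold M A"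
    and compact_M: "compact M"
    and metric: "riemannian_metric A g"
    and morse: "morse_function A f"
begin

definition coords :: "('m, 'e) chart \<Rightarrow> 'e set" where
  "coords c = snd c ` fst c"

lemma chart:
  assumes "c \<in> A"
  shows "openin (top_of_set M) (fst c)" "open (coords c)"
    "homeomorphism (fst c) (coords c) (snd c) (chart_inv c)"
  using manifold assms by (auto simp: smooth_manifold_def is_chart_def coords_def)

lemma fst_chart_subset: "fst c \<subseteq> M" if "c \<in> A"
  using chart(1)[OF that] by (rule openin_imp_subset)

lemma chart_inverse:
  assumes "c \<in> A"
  shows "p \<in> fst c \<Longrightarrow> chart_inv c (snd c p) = p"
    and "x \<in> coords c \<Longrightarrow> snd c (chart_inv c x) = x"
    and "x \<in> coords c \<Longrightarrow> chart_inv c x \<in> fst c"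
    and "p \<in> fst c \<Longrightarrow> snd c p \<in> coords c"
  using chart(3)[OF assms] by (auto simp: homeomorphism_def)

lemma chart_exists: "\<exists>c\<in>A. p \<in> fst c" if "p \<in> M"
  using manifold that by (auto simp: smooth_manifold_def)

lemma metric_at:
  assumes "c \<in> A" "p \<in> fst c"
  shows "bilinear (g c p)" "u \<noteq> 0 \<Longrightarrow> 0 < g c p u u"
  using metric assms unfolding riemannian_metric_def by blast+

lemma metric_coord_change:
  assumes "c \<in> A" "c' \<in> A" "p \<in> fst c" "p \<in> fst c'"
  shows "g c p u v = g c' p (coord_change c c' p u) (coord_change c c' p v)"
  using metric assms unfolding riemannian_metric_def by blast

lemma metric_smooth: "smooth_on (coords c) (\<lambda>x. g c (chart_inv c x) u v)" if "c \<in> A"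
  using metric that unfolding riemannian_metric_def coords_def by blast

lemma open_image_chart:
  assumes "c \<in> A" "openin (top_of_set M) U" "U \<subseteq> fst c"
  shows "open (snd c ` U)"
proof -
  have "openin (top_of_set (fst c)) U"
    using assms chart(1)[OF assms(1)] by (meson fst_chart_subset openin_subset_trans)
  then have "openin (top_of_set (coords c)) (snd c ` U)"
    by (rule homeomorphism_imp_open_map[OF chart(3)[OF assms(1)]])
  then show ?thesis
    using chart(2)[OF assms(1)] by (simp add: openin_open_eq)
qed

lemma transition_differentiable:
  assumes "c \<in> A" "c' \<in> A" "x \<in> snd c ` (fst c \<inter> fst c')"
  shows "(snd c' \<circ> chart_inv c) differentiable (at x)"
proof -
  have "Ck_on (Suc 0) (snd c ` (fst c \<inter> fst c')) (snd c' \<circ> chart_inv c)"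
    using manifold assms(1,2) unfolding smooth_manifold_def smooth_on_def by blast
  then show ?thesis using assms(3) by auto
qed

lemma open_overlap: "open (snd c ` (fst c \<inter> fst c'))" if "c \<in> A" "c' \<in> A"
  using that chart(1) by (intro open_image_chart openin_Int) auto

lemma coord_change:
  assumes "c \<in> A" "c' \<in> A" "p \<in> fst c" "p \<in> fst c'"
  shows "((snd c' \<circ> chart_inv c) has_derivative coord_change c c' p) (at (snd c p))"
  unfolding coord_change_def
  using transition_differentiable[OF assms(1,2), of "snd c p"] assms(3,4)
  by (simp add: frechet_derivative_works[symmetric])

lemma coord_change_inverse:
  assumes "c \<in> A" "c' \<in> A" "p \<in> fst c" "p \<in> fst c'"
  shows "coord_change c c' p (coord_change c' c p v) = v"
proof -
  have "(snd c \<circ> chart_inv c') (snd c' p) = snd c p"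
    using chart_inverse(1)[OF assms(2,4)] by simp
  with coord_change[OF assms(1,2,3,4)] coord_change[OF assms(2,1,4,3)]
  have "((snd c' \<circ> chart_inv c) \<circ> (snd c \<circ> chart_inv c') has_derivative
      coord_change c c' p \<circ> coord_change c' c p) (at (snd c' p))"
    by (metis diff_chain_at)
  then have "((\<lambda>x. x) has_derivative coord_change c c' p \<circ> coord_change c' c p) (at (snd c' p))"
  proof (rule has_derivative_transform_within_open[OF _ open_overlap[OF assms(2,1)]])
    show "snd c' p \<in> snd c' ` (fst c' \<inter> fst c)" using assms by auto
    show "((snd c' \<circ> chart_inv c) \<circ> (snd c \<circ> chart_inv c')) x = x"
      if "x \<in> snd c' ` (fst c' \<inter> fst c)" for x
      using that by (auto simp: chart_inverse(1)[OF assms(1)] chart_inverse(1)[OF assms(2)])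
  qed
  from has_derivative_unique[OF this has_derivative_ident] show ?thesis
    by (metis comp_apply)
qed

lemma f_smooth: "smooth_on (coords c) (f \<circ> chart_inv c)" if "c \<in> A"
  using morse that by (auto simp: morse_function_def smooth_function_def coords_def)

lemma differential:
  assumes "c \<in> A" "p \<in> fst c"
  shows "((f \<circ> chart_inv c) has_derivative differential f c p) (at (snd c p))"
proof -
  have "Ck_on (Suc 0) (coords c) (f \<circ> chart_inv c)"
    using f_smooth[OF assms(1)] unfolding smooth_on_def by blast
  then show ?thesis
    using chart_inverse(4)[OF assms] by (simp add: differential_def frechet_derivative_works[symmetric])
qed

lemma differential_coord_change:
  assumes "c \<in> A" "c' \<in> A" "p \<in> fst c" "p \<in> fst c'"
  shows "differential f c' p (coord_change c c' p v) = differential f c p v"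
proof -
  have "(snd c' \<circ> chart_inv c) (snd c p) = snd c' p"
    using chart_inverse(1)[OF assms(1,3)] by simp
  with coord_change[OF assms] differential[OF assms(2,4)]
  have "((f \<circ> chart_inv c') \<circ> (snd c' \<circ> chart_inv c) has_derivative
      differential f c' p \<circ> coord_change c c' p) (at (snd c p))"
    by (metis diff_chain_at)
  then have "((f \<circ> chart_inv c) has_derivative differential f c' p \<circ> coord_change c c' p) (at (snd c p))"
  proof (rule has_derivative_transform_within_open[OF _ open_overlap[OF assms(1,2)]])
    show "snd c p \<in> snd c ` (fst c \<inter> fst c')" using assms by auto
    show "((f \<circ> chart_inv c') \<circ> (snd c' \<circ> chart_inv c)) x = (f \<circ> chart_inv c) x"
      if "x \<in> snd c ` (fst c \<inter> fst c')" for x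
      using that by (auto simp: chart_inverse(1)[OF assms(1)] chart_inverse(1)[OF assms(2)])
  qed
  from has_derivative_unique[OF this differential[OF assms(1,3)]] show ?thesis
    by (metis comp_apply)
qed

text \<open>Together with the next lemma this shows that the definite description in the definition of the
gradient is proper: it exists and is unique by positive definiteness of the metric.\<close>

lemma gradient_unique:
  assumes "c \<in> A" "p \<in> fst c" "\<And>v. g c p w v = differential f c p v"
  shows "gradient g f c p = w"
  unfolding gradient_def
proof (rule the_equality)
  fix w' assume w': "\<forall>v. g c p w' v = differential f c p v"
  have "g c p (w' - w) (w' - w) = 0"
    using w' assms(3) bilinear_lsub[OF metric_at(1)[OF assms(1,2)]] by simp
  then show "w' = w"
    using metric_at(2)[OF assms(1,2), of "w' - w"] by fastforce
qed (use assms in auto)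

lemma gradient:
  assumes "c \<in> A" "p \<in> fst c"
  shows "g c p (gradient g f c p) v = differential f c p v"
proof -
  note bil = metric_at(1)[OF assms]
  define T where "T w = (\<Sum>b\<in>Basis. g c p w b *\<^sub>R b)" for w
  have T_inner: "T w \<bullet> v = g c p w v" for w v
  proof -
    have "g c p w v = g c p w (\<Sum>b\<in>Basis. (v \<bullet> b) *\<^sub>R b)"
      by (simp add: euclidean_representation)
    also have "\<dots> = (\<Sum>b\<in>Basis. (v \<bullet> b) * g c p w b)"
      using bil by (simp add: bilinear_def linear_sum linear_scale)
    finally show ?thesis
      by (simp add: T_def inner_sum_left inner_commute[of v] mult.commute)
  qed
  have "linear T"
    unfolding T_def using bil
    by (intro linearI) (simp_all add: bilinear_ladd bilinear_lmul scaleR_left_distrib sum.distrib scaleR_sum_right)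
  moreover have "inj T"
    unfolding linear_injective_0[OF \<open>linear T\<close>]
    using T_inner metric_at(2)[OF assms] by (metis inner_zero_left less_irrefl)
  ultimately have "surj T"
    by (rule linear_injective_imp_surjective[OF _ _ refl])
  then obtain w where "T w = (\<Sum>b\<in>Basis. differential f c p b *\<^sub>R b)"
    by (metis surjD)
  then have "g c p w v = (\<Sum>b\<in>Basis. differential f c p b *\<^sub>R b) \<bullet> v" for v
    using T_inner by metis
  moreover have "(\<Sum>b\<in>Basis. differential f c p b *\<^sub>R b) \<bullet> v = differential f c p v" for v
  proof -
    have lin: "linear (differential f c p)"
      using differential[OF assms] by (rule has_derivative_linear)
    have "differential f c p v = differential f c p (\<Sum>b\<in>Basis. (v \<bullet> b) *\<^sub>R b)"
      by (simp add: euclidean_representation)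
    also have "\<dots> = (\<Sum>b\<in>Basis. (v \<bullet> b) * differential f c p b)"
      using lin by (simp add: linear_sum linear_scale)
    finally show ?thesis
      by (simp add: inner_sum_left inner_commute[of v] mult.commute)
  qed
  ultimately have w: "g c p w v = differential f c p v" for v
    by simp
  then show ?thesis
    using gradient_unique[OF assms w] by simp
qed

text \<open>The gradient is a vector field on the manifold. Hence a curve that solves the flow equation in one
chart solves it in every chart.\<close>

lemma gradient_coord_change:
  assumes "c \<in> A" "c' \<in> A" "p \<in> fst c" "p \<in> fst c'"
  shows "coord_change c c' p (gradient g f c p) = gradient g f c' p"
proof (rule gradient_unique[OF assms(2,4), symmetric])
  fix v'
  define v where "v = coord_change c' c p v'"
  have v': "v' = coord_change c c' p v"
    using coord_change_inverse[OF assms] by (simp add: v_def)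
  have "g c' p (coord_change c c' p (gradient g f c p)) (coord_change c c' p v) = g c p (gradient g f c p) v"
    using metric_coord_change[OF assms] by simp
  also have "\<dots> = differential f c' p (coord_change c c' p v)"
    using gradient[OF assms(1,3)] differential_coord_change[OF assms] by simp
  finally show "g c' p (coord_change c c' p (gradient g f c p)) v' = differential f c' p v'"
    by (simp add: v')
qed

definition grad :: "('m, 'e) chart \<Rightarrow> 'e \<Rightarrow> 'e" where
  "grad c x = gradient g f c (chart_inv c x)"

lemma grad_at: "grad c (snd c p) = gradient g f c p" if "c \<in> A" "p \<in> fst c"
  using chart_inverse(1)[OF that] by (simp add: grad_def)

lemma local_gradient_chart:
  assumes "c \<in> A"
  shows "local_gradient (coords c) (\<lambda>x. g c (chart_inv c x)) (f \<circ> chart_inv c) (grad c)"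
proof
  fix x u v
  show "open (coords c)" by (rule chart(2)[OF assms])
  show "Ck_on (Suc (Suc 0)) (coords c) (f \<circ> chart_inv c)"
    using f_smooth[OF assms] unfolding smooth_on_def by blast
  show "Ck_on (Suc 0) (coords c) (\<lambda>x. g c (chart_inv c x) u v)"
    using metric_smooth[OF assms] unfolding smooth_on_def by blast
  assume x: "x \<in> coords c"
  note inv = chart_inverse(3)[OF assms x]
  show "bilinear (g c (chart_inv c x))"
    by (rule metric_at[OF assms inv])
  show "u \<noteq> 0 \<Longrightarrow> 0 < g c (chart_inv c x) u u"
    by (rule metric_at[OF assms inv])
  show "g c (chart_inv c x) (grad c x) v = frechet_derivative (f \<circ> chart_inv c) (at x) v"
    using gradient[OF assms inv, of v] chart_inverse(2)[OF assms x]
    by (simp add: grad_def differential_def)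
qed


section \<open>Existence of flow lines for a uniform time\<close>

text \<open>Gradient flow lines on an arbitrary set of times, with one-sided derivatives at its boundary, so
that closed intervals are allowed and flow lines can be glued at a common endpoint.\<close>

definition flow :: "real set \<Rightarrow> (real \<Rightarrow> 'm) \<Rightarrow> bool" where
  "flow I \<gamma> \<longleftrightarrow> continuous_on I \<gamma> \<and> \<gamma> ` I \<subseteq> M \<and>
     (\<forall>t\<in>I. \<forall>c\<in>A. \<gamma> t \<in> fst c \<longrightarrow>
        ((snd c \<circ> \<gamma>) has_vector_derivative - gradient g f c (\<gamma> t)) (at t within I))"

lemma gradient_flow_line_UNIV: "gradient_flow_line M A g f (-\<infinity>) \<infinity> \<gamma> \<longleftrightarrow> flow UNIV \<gamma>"
  by (simp add: gradient_flow_line_def flow_def)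

lemma flow_subset: "flow J \<gamma>" if "flow I \<gamma>" "J \<subseteq> I"
  using that unfolding flow_def
  by (meson continuous_on_subset has_vector_derivative_within_subset image_mono order_trans subsetD)

lemma flow_continuous: "continuous_on I \<gamma>" if "flow I \<gamma>"
  using that unfolding flow_def by blast

lemma flow_gradient:
  "((snd c \<circ> \<gamma>) has_vector_derivative - gradient g f c (\<gamma> t)) (at t within I)"
  if "flow I \<gamma>" "t \<in> I" "c \<in> A" "\<gamma> t \<in> fst c"
  using that unfolding flow_def by blast

lemma flow_in: "\<gamma> t \<in> M" if "flow I \<gamma>" "t \<in> I"
  using that by (auto simp: flow_def)

lemma flow_deriv:
  "((snd c \<circ> \<gamma>) has_vector_derivative - grad c (snd c (\<gamma> t))) (at t within I)"
  if "flow I \<gamma>" "t \<in> I" "c \<in> A" "\<gamma> t \<in> fst c"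
  using flow_gradient[OF that] that by (simp add: grad_at)

lemma flow_shift:
  assumes "flow I \<gamma>" "(\<lambda>t. t + s) ` J \<subseteq> I"
  shows "flow J (\<lambda>t. \<gamma> (t + s))"
  unfolding flow_def
proof (intro conjI ballI impI)
  show "continuous_on J (\<lambda>t. \<gamma> (t + s))"
    using assms(2) by (intro continuous_on_compose2[OF flow_continuous[OF assms(1)]] continuous_intros) auto
  show "(\<lambda>t. \<gamma> (t + s)) ` J \<subseteq> M"
    using assms flow_in by blast
  fix t c assume t: "t \<in> J" and c: "c \<in> A" "\<gamma> (t + s) \<in> fst c"
  then have "t + s \<in> I" using assms(2) by auto
  then have d: "((snd c \<circ> \<gamma>) has_vector_derivative - gradient g f c (\<gamma> (t + s))) (at (t + s) within I)"
    using flow_gradient[OF assms(1) _ c] by blast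
  have "((\<lambda>t. t + s) has_vector_derivative 1) (at t within J)"
    by (auto intro!: derivative_eq_intros)
  from vector_diff_chain_within[OF this has_vector_derivative_within_subset[OF d assms(2)]]
  show "((snd c \<circ> (\<lambda>t. \<gamma> (t + s))) has_vector_derivative - gradient g f c (\<gamma> (t + s))) (at t within J)"
    by (simp add: o_def)
qed

lemma flow_join:
  assumes "flow {a..b} \<gamma>" "flow {b..d} \<delta>" "\<gamma> b = \<delta> b" "a \<le> b" "b \<le> d"
  shows "flow {a..d} (\<lambda>t. if t \<le> b then \<gamma> t else \<delta> t)"
  unfolding flow_def
proof (intro conjI ballI impI)
  have ad: "{a..d} = {a..b} \<union> {b..d}" using assms by auto
  show "continuous_on {a..d} (\<lambda>t. if t \<le> b then \<gamma> t else \<delta> t)"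
    unfolding ad using assms(3-5) flow_continuous[OF assms(1)] flow_continuous[OF assms(2)]
    by (intro continuous_on_If) auto
  show "(\<lambda>t. if t \<le> b then \<gamma> t else \<delta> t) ` {a..d} \<subseteq> M"
    using flow_in[OF assms(1)] flow_in[OF assms(2)] by auto
  fix t c assume t: "t \<in> {a..d}" and c: "c \<in> A" "(if t \<le> b then \<gamma> t else \<delta> t) \<in> fst c"
  have d1: "((snd c \<circ> \<gamma>) has_vector_derivative - gradient g f c (\<gamma> t)) (at t within {a..b})"
    if "t \<in> {a..b}" "\<gamma> t \<in> fst c"
    using flow_gradient[OF assms(1) _ c(1)] that by blast
  have d2: "((snd c \<circ> \<delta>) has_vector_derivative - gradient g f c (\<delta> t)) (at t within {b..d})"
    if "t \<in> {b..d}" "\<delta> t \<in> fst c"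
    using flow_gradient[OF assms(2) _ c(1)] that by blast
  have "((\<lambda>t. if t \<in> {a..b} then (snd c \<circ> \<gamma>) t else (snd c \<circ> \<delta>) t) has_vector_derivative
      (if t \<in> {a..b} then - gradient g f c (\<gamma> t) else - gradient g f c (\<delta> t))) (at t within {a..d})"
  proof (rule has_vector_derivative_If_within_closures[OF _ ad])
    have cl: "closure {a..b} \<inter> closure {b..d} = {b}" using assms by auto
    show "t \<in> {a..b} \<union> {b..d}" using t ad by simp
    show "((snd c \<circ> \<gamma>) has_vector_derivative - gradient g f c (\<gamma> t))
        (at t within {a..b} \<union> closure {a..b} \<inter> closure {b..d})"
      if "t \<in> {a..b} \<union> closure {a..b} \<inter> closure {b..d}"
    proof -
      have "{a..b} \<union> closure {a..b} \<inter> closure {b..d} = {a..b}" using cl assms by auto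
      then show ?thesis using that d1 c(2) by simp
    qed
    show "((snd c \<circ> \<delta>) has_vector_derivative - gradient g f c (\<delta> t))
        (at t within {b..d} \<union> closure {a..b} \<inter> closure {b..d})"
      if "t \<in> {b..d} \<union> closure {a..b} \<inter> closure {b..d}"
    proof -
      have "{b..d} \<union> closure {a..b} \<inter> closure {b..d} = {b..d}" using cl assms by auto
      moreover from this have "\<delta> t \<in> fst c"
        using that c(2) assms(3) by (cases "t = b") auto
      ultimately show ?thesis using that d2 by simp
    qed
    show "(snd c \<circ> \<gamma>) t = (snd c \<circ> \<delta>) t"
      and "- gradient g f c (\<gamma> t) = - gradient g f c (\<delta> t)"
      if "t \<in> closure {a..b}" "t \<in> closure {b..d}"
      using that assms(3) cl by (auto simp: set_eq_iff)
  qed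
  then have "((\<lambda>t. if t \<in> {a..b} then (snd c \<circ> \<gamma>) t else (snd c \<circ> \<delta>) t) has_vector_derivative
      - gradient g f c (if t \<le> b then \<gamma> t else \<delta> t)) (at t within {a..d})"
    using t by (auto split: if_splits)
  then show "((snd c \<circ> (\<lambda>t. if t \<le> b then \<gamma> t else \<delta> t)) has_vector_derivative
      - gradient g f c (if t \<le> b then \<gamma> t else \<delta> t)) (at t within {a..d})"
    by (rule has_vector_derivative_transform[OF t, rotated]) auto
qed

definition chart_ball :: "('m, 'e) chart \<Rightarrow> 'e \<Rightarrow> real \<Rightarrow> 'm set" where
  "chart_ball c x0 r = {p \<in> fst c. snd c p \<in> ball x0 r}"

lemma openin_preimage:
  assumes "c \<in> A" "open T"
  shows "openin (top_of_set M) {p \<in> fst c. snd c p \<in> T}"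
proof -
  have "continuous_on (fst c) (snd c)"
    using chart(3)[OF assms(1)] by (simp add: homeomorphism_def)
  then have "openin (top_of_set (fst c)) (fst c \<inter> snd c -` T)"
    using assms(2) by (rule continuous_openin_preimage_gen)
  then have "openin (top_of_set M) (fst c \<inter> snd c -` T)"
    using chart(1)[OF assms(1)] by (rule openin_trans)
  moreover have "fst c \<inter> snd c -` T = {p \<in> fst c. snd c p \<in> T}" by auto
  ultimately show ?thesis by simp
qed

lemma openin_chart_ball: "openin (top_of_set M) (chart_ball c x0 r)" if "c \<in> A"
  unfolding chart_ball_def by (rule openin_preimage[OF that open_ball])

lemma compact_preimage:
  assumes "c \<in> A" "compact K" "K \<subseteq> coords c"
  shows "compact {p \<in> fst c. snd c p \<in> K}"
proof -
  have "continuous_on K (chart_inv c)"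
    using chart(3)[OF assms(1)] assms(3) by (auto simp: homeomorphism_def intro: continuous_on_subset)
  then have "compact (chart_inv c ` K)"
    using assms(2) by (rule compact_continuous_image)
  moreover have "chart_inv c ` K = {p \<in> fst c. snd c p \<in> K}"
    using chart_inverse[OF assms(1)] assms(3) by (force simp: image_iff subset_iff)
  ultimately show ?thesis by simp
qed

text \<open>A coordinate ball on which the gradient is bounded by \<open>K\<close> and has Lipschitz constant \<open>L\<close>.\<close>

definition tame :: "('m, 'e) chart \<Rightarrow> 'e \<Rightarrow> real \<Rightarrow> real \<Rightarrow> real \<Rightarrow> bool" where
  "tame c x0 r K L \<longleftrightarrow> c \<in> A \<and> 0 < r \<and> 0 \<le> K \<and> 0 \<le> L \<and> cball x0 r \<subseteq> coords c \<and>
     (\<forall>x\<in>cball x0 r. norm (grad c x) \<le> K \<and>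
        (\<forall>y\<in>cball x0 r. norm (grad c x - grad c y) \<le> L * norm (x - y)))"

lemma tame_exists:
  assumes "c \<in> A" "p \<in> fst c"
  shows "\<exists>K L. \<forall>\<^sub>F r in at_right 0. tame c (snd c p) r K L"
proof -
  interpret lg: local_gradient "coords c" "\<lambda>x. g c (chart_inv c x)" "f \<circ> chart_inv c" "grad c"
    by (rule local_gradient_chart[OF assms(1)])
  have p: "snd c p \<in> coords c" by (rule chart_inverse(4)[OF assms])
  obtain K L where KL: "0 \<le> K" "0 \<le> L"
    "\<forall>\<^sub>F r in at_right 0. \<forall>x\<in>cball (snd c p) r. norm (grad c x) \<le> K \<and>
        (\<forall>y\<in>cball (snd c p) r. norm (grad c x - grad c y) \<le> L * norm (x - y))"
    using lg.gradient_Lipschitz[OF p] by blast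
  have "\<forall>\<^sub>F r in at_right 0. \<forall>x\<in>cball (snd c p) r. x \<in> coords c"
    using p chart(2)[OF assms(1)] by (intro eventually_all_in_cball eventually_nhds_in_open)
  with KL(3) have "\<forall>\<^sub>F r in at_right 0. tame c (snd c p) r K L"
    using eventually_at_right_less[of 0]
  proof eventually_elim
    case (elim r)
    then show ?case
      unfolding tame_def using assms(1) KL(1,2) by blast
  qed
  then show ?thesis by blast
qed

text \<open>At the first time of exit the flow line is still in the closed coordinate ball, which is compact and
therefore closed in \<open>M\<close>. Up to then its speed in the chart is at most \<open>K\<close>, so it has covered
less than the distance \<open>r / 2\<close> to the boundary.\<close>

lemma flow_stays_in_chart_ball:
  assumes tame: "tame c x0 r K L" and flow: "flow {0..h} \<gamma>"
    and start: "\<gamma> 0 \<in> chart_ball c x0 (r/2)" and "K * h < r/2" "t \<in> {0..h}"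
  shows "\<gamma> t \<in> chart_ball c x0 r"
proof (rule ccontr)
  assume bad: "\<gamma> t \<notin> chart_ball c x0 r"
  have c: "c \<in> A" "0 < r" "0 \<le> K" "cball x0 r \<subseteq> coords c"
    and speed: "\<And>x. x \<in> cball x0 r \<Longrightarrow> norm (grad c x) \<le> K"
    using tame by (auto simp: tame_def)
  have cont: "continuous_on {0..h} \<gamma>" using flow by (rule flow_continuous)
  define S where "S = {s \<in> {0..h}. \<gamma> s \<notin> chart_ball c x0 r}"
  obtain T where T: "open T" "chart_ball c x0 r = M \<inter> T"
    using openin_chart_ball[OF c(1)] unfolding openin_open by blast
  have "S = {0..h} \<inter> \<gamma> -` (- T)"
    using T(2) flow_in[OF flow] by (auto simp: S_def)
  then have "closedin (top_of_set {0..h}) S"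
    using continuous_closedin_preimage[OF cont, of "- T"] T(1) by (simp add: closed_Compl)
  then have "compact S"
    by (meson closedin_compact compact_Icc)
  moreover have "S \<noteq> {}" using bad \<open>t \<in> {0..h}\<close> by (auto simp: S_def)
  ultimately obtain s where s: "s \<in> S" "\<And>s'. s' \<in> S \<Longrightarrow> s \<le> s'"
    using compact_attains_inf[of S] by blast
  define C where "C = {p \<in> fst c. snd c p \<in> cball x0 r}"
  have "closed C"
    unfolding C_def using c by (intro compact_imp_closed compact_preimage) auto
  have before: "\<gamma> s' \<in> C" if "0 \<le> s'" "s' < s" for s'
  proof -
    have "s' \<notin> S" using s(2) that by force
    then have "\<gamma> s' \<in> chart_ball c x0 r" using that s(1) by (auto simp: S_def)
    then show ?thesis by (auto simp: C_def chart_ball_def)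
  qed
  have "\<gamma> 0 \<in> chart_ball c x0 r" using start c(2) by (simp add: chart_ball_def)
  then have "0 < s" using s(1) by (cases "s = 0") (auto simp: S_def)
  have sh: "s \<le> h" using s(1) by (simp add: S_def)
  have "\<gamma> s \<in> C"
  proof -
    have "continuous_on {0..s} \<gamma>" using cont sh by (auto intro: continuous_on_subset)
    moreover have "closure {0..<s} = {0..s}" using \<open>0 < s\<close> by simp
    ultimately have "\<gamma> ` closure {0..<s} \<subseteq> C"
      using \<open>closed C\<close> before by (intro image_closure_subset) auto
    then show ?thesis using \<open>closure {0..<s} = {0..s}\<close> \<open>0 < s\<close> by auto
  qed
  then have in_C: "\<gamma> u \<in> C" if "u \<in> {0..s}" for u
    using before[of u] that by (cases "u = s") auto
  have "norm ((snd c \<circ> \<gamma>) s - (snd c \<circ> \<gamma>) 0) \<le> K * \<bar>s - 0\<bar>"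
  proof (rule norm_diff_le_speed[where S = "{0..s}"])
    fix u assume u: "u \<in> {0..s}"
    have flow_s: "flow {0..s} \<gamma>"
      using flow sh by (auto intro: flow_subset)
    show "((snd c \<circ> \<gamma>) has_vector_derivative - grad c (snd c (\<gamma> u))) (at u within {0..s})"
      using in_C[OF u] by (intro flow_deriv[OF flow_s u c(1)]) (simp add: C_def)
    show "norm (- grad c (snd c (\<gamma> u))) \<le> K"
      using in_C[OF u] speed by (simp add: C_def)
  qed (use \<open>0 < s\<close> in auto)
  also have "\<dots> \<le> K * h" using sh \<open>0 < s\<close> c(3) by (simp add: mult_left_mono)
  finally have "norm (snd c (\<gamma> s) - snd c (\<gamma> 0)) < r/2" using \<open>K * h < r/2\<close> by simp
  moreover have "dist x0 (snd c (\<gamma> 0)) < r/2" using start by (simp add: chart_ball_def)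
  ultimately have "snd c (\<gamma> s) \<in> ball x0 r"
    using dist_triangle[of x0 "snd c (\<gamma> s)" "snd c (\<gamma> 0)"] by (simp add: dist_norm norm_minus_commute)
  then have "\<gamma> s \<in> chart_ball c x0 r" using \<open>\<gamma> s \<in> C\<close> by (simp add: C_def chart_ball_def)
  then show False using s(1) by (simp add: S_def)
qed

lemma flow_locally_exists:
  assumes "tame c x0 r K L" and a: "a \<in> chart_ball c x0 (r/2)" and "0 < h" "K * h < r/2" "L * h \<le> 1/8"
  shows "\<exists>\<gamma>. flow {-h..h} \<gamma> \<and> \<gamma> 0 = a"
proof -
  have c: "c \<in> A" "0 < r" "0 \<le> K" "0 \<le> L" "cball x0 r \<subseteq> coords c"
    and bounds: "\<And>x. x \<in> cball x0 r \<Longrightarrow> norm (grad c x) \<le> K"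
     "\<And>x y. x \<in> cball x0 r \<Longrightarrow> y \<in> cball x0 r \<Longrightarrow> norm (grad c x - grad c y) \<le> L * norm (x - y)"
    using assms(1) by (auto simp: tame_def)
  have "\<exists>x. x 0 = snd c a \<and> (\<forall>t\<in>{-h..h}. x t \<in> cball x0 r \<and>
      (x has_vector_derivative - grad c (x t)) (at t within {-h..h}))"
  proof (rule flow_in_ball_exists[where K = K and L = L])
    show "norm (- grad c x - - grad c y) \<le> L * norm (x - y)" if "x \<in> cball x0 r" "y \<in> cball x0 r" for x y
      using bounds(2)[OF that] by (simp add: norm_minus_commute)
  qed (use assms c bounds(1) in \<open>auto simp: chart_ball_def\<close>)
  then obtain x where x: "x 0 = snd c a" "\<And>t. t \<in> {-h..h} \<Longrightarrow> x t \<in> coords c"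
      "\<And>t. t \<in> {-h..h} \<Longrightarrow> (x has_vector_derivative - grad c (x t)) (at t within {-h..h})"
    using c(5) by blast
  have "flow {-h..h} (\<lambda>t. chart_inv c (x t))"
    unfolding flow_def
  proof (intro conjI ballI impI)
    have "continuous_on {-h..h} x"
      using x(3) by (meson continuous_on_vector_derivative)
    moreover have "continuous_on (coords c) (chart_inv c)"
      using chart(3)[OF c(1)] by (simp add: homeomorphism_def)
    ultimately show "continuous_on {-h..h} (\<lambda>t. chart_inv c (x t))"
      using continuous_on_compose2[of "coords c" "chart_inv c" "{-h..h}" x] x(2) by blast
    show "(\<lambda>t. chart_inv c (x t)) ` {-h..h} \<subseteq> M"
      using chart_inverse(3)[OF c(1)] x(2) fst_chart_subset[OF c(1)] by blast
    fix t c' assume t: "t \<in> {-h..h}" and c': "c' \<in> A" "chart_inv c (x t) \<in> fst c'"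
    let ?p = "chart_inv c (x t)"
    have p: "?p \<in> fst c" "snd c ?p = x t"
      using chart_inverse[OF c(1)] x(2)[OF t] by auto
    have "((snd c' \<circ> chart_inv c) has_derivative coord_change c c' ?p) (at (x t) within x ` {-h..h})"
      using coord_change[OF c(1) c'(1) p(1) c'(2)] p(2) by (simp add: has_derivative_at_withinI)
    from vector_derivative_diff_chain_within[OF x(3)[OF t] this]
    have "((snd c' \<circ> chart_inv c \<circ> x) has_vector_derivative coord_change c c' ?p (- grad c (x t))) (at t within {-h..h})" .
    moreover have "coord_change c c' ?p (- grad c (x t)) = - gradient g f c' ?p"
      using gradient_coord_change[OF c(1) c'(1) p(1) c'(2)]
        linear_neg[OF has_derivative_linear[OF coord_change[OF c(1) c'(1) p(1) c'(2)]]]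
      by (simp add: grad_def)
    ultimately show "((snd c' \<circ> (\<lambda>t. chart_inv c (x t))) has_vector_derivative - gradient g f c' ?p) (at t within {-h..h})"
      by (simp add: o_def)
  qed
  moreover have "chart_inv c (x 0) = a"
    using a chart_inverse(1)[OF c(1)] by (simp add: x(1) chart_ball_def)
  ultimately show ?thesis by blast
qed

lemma finite_subcover:
  assumes "\<And>p. p \<in> M \<Longrightarrow> open (T p)" "\<And>p. p \<in> M \<Longrightarrow> p \<in> T p"
  obtains D where "D \<subseteq> M" "finite D" "M \<subseteq> (\<Union>p\<in>D. T p)"
proof -
  have "M \<subseteq> (\<Union>p\<in>M. T p)" using assms(2) by blast
  from compactE_image[OF compact_M assms(1) this] show ?thesis using that by metis
qed

text \<open>A length of time that works everywhere: every point is in the inner half of a tame ball that no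
flow line starting there can leave within time \<open>h\<close>, and in which Picard's theorem applies.\<close>

definition admissible_step :: "real \<Rightarrow> bool" where
  "admissible_step h \<longleftrightarrow> 0 < h \<and> (\<forall>p\<in>M. \<exists>c x0 r K L. tame c x0 r K L \<and> p \<in> chart_ball c x0 (r/2) \<and>
     K * h < r/2 \<and> L * h \<le> 1/8)"

lemma admissible_step_exists: "\<exists>h. admissible_step h"
proof -
  define good where "good h p \<longleftrightarrow> (\<exists>c x0 r K L. tame c x0 r K L \<and> p \<in> chart_ball c x0 (r/2) \<and> K * h < r/2 \<and> L * h \<le> 1/8)"
    for h p
  have good_mono: "good h p" if "good h' p" "h \<le> h'" for h h' p
    using that unfolding good_def tame_def by (meson le_less_trans mult_left_mono order_trans)
  have "\<exists>T h. open T \<and> p \<in> T \<and> 0 < h \<and> (\<forall>q\<in>M \<inter> T. good h q)" if "p \<in> M" for p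
  proof -
    obtain c where c: "c \<in> A" "p \<in> fst c" using chart_exists[OF \<open>p \<in> M\<close>] by blast
    obtain K L where "\<forall>\<^sub>F r in at_right 0. tame c (snd c p) r K L"
      using tame_exists[OF c] by blast
    from eventually_happens'[OF _ this] obtain r where r: "tame c (snd c p) r K L" by auto
    then have pos: "0 < r" "0 \<le> K" "0 \<le> L" by (auto simp: tame_def)
    define h where "h = min (r / (4 * (K + 1))) (1 / (8 * (L + 1)))"
    have "0 < h" using pos by (simp add: h_def)
    have "h \<le> r / (4 * (K + 1))" "h \<le> 1 / (8 * (L + 1))" by (simp_all add: h_def)
    then have "h * (4 * (K + 1)) \<le> r" "h * (8 * (L + 1)) \<le> 1"
      using pos pos_le_divide_eq[of "4 * (K + 1)" h r] pos_le_divide_eq[of "8 * (L + 1)" h 1] by auto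
    then have "K * h < r / 2" "L * h \<le> 1 / 8"
      using \<open>0 < h\<close> mult_nonneg_nonneg[OF pos(2), of h] mult_nonneg_nonneg[OF pos(3), of h]
      by (simp_all add: algebra_simps)
    obtain T where T: "open T" "chart_ball c (snd c p) (r/2) = M \<inter> T"
      using openin_chart_ball[OF c(1)] unfolding openin_open by blast
    have "p \<in> chart_ball c (snd c p) (r/2)" using c pos by (simp add: chart_ball_def)
    then have "p \<in> T" using T(2) by blast
    moreover have "good h q" if "q \<in> M \<inter> T" for q
      unfolding good_def
      using that T(2) r \<open>K * h < r / 2\<close> \<open>L * h \<le> 1 / 8\<close>
      by (intro exI[of _ c] exI[of _ "snd c p"] exI[of _ r] exI[of _ K] exI[of _ L]) simp
    ultimately show ?thesis
      using T(1) \<open>0 < h\<close> by blast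
  qed
  then obtain T h where Th: "\<And>p. p \<in> M \<Longrightarrow> open (T p) \<and> p \<in> T p \<and> 0 < h p \<and> (\<forall>q\<in>M \<inter> T p. good (h p) q)"
    by metis
  obtain D where D: "D \<subseteq> M" "finite D" "M \<subseteq> (\<Union>p\<in>D. T p)"
    by (rule finite_subcover[of T]) (use Th in blast)+
  define h0 where "h0 = Min (insert 1 (h ` D))"
  have "0 < h0" using D Th unfolding h0_def by (subst Min_gr_iff) auto
  moreover have "good h0 p" if "p \<in> M" for p
  proof -
    obtain q where q: "q \<in> D" "p \<in> T q" using D(3) \<open>p \<in> M\<close> by blast
    then have "good (h q) p" using Th D(1) \<open>p \<in> M\<close> by blast
    moreover have "h0 \<le> h q" using D(2) q(1) by (auto simp: h0_def)
    ultimately show ?thesis by (rule good_mono)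
  qed
  ultimately show ?thesis unfolding good_def admissible_step_def by blast
qed


section \<open>Null sets and the flow\<close>

lemma measure_zero_subset: "measure_zero M A N'" if "measure_zero M A N" "N' \<subseteq> N"
  using that unfolding measure_zero_def
  by (meson Int_mono image_mono negligible_subset order_refl order_trans)

lemma measure_zero_UN:
  assumes "countable I" "\<And>i. i \<in> I \<Longrightarrow> measure_zero M A (N i)"
  shows "measure_zero M A (\<Union>i\<in>I. N i)"
  unfolding measure_zero_def
proof (intro conjI ballI)
  show "(\<Union>i\<in>I. N i) \<subseteq> M"
    using assms(2) unfolding measure_zero_def by blast
  fix c assume "c \<in> A"
  have "negligible (\<Union>((\<lambda>i. snd c ` (N i \<inter> fst c)) ` I))"
    using assms \<open>c \<in> A\<close> unfolding measure_zero_def by (intro negligible_countable_Union) auto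
  moreover have "snd c ` ((\<Union>i\<in>I. N i) \<inter> fst c) = \<Union>((\<lambda>i. snd c ` (N i \<inter> fst c)) ` I)"
    by blast
  ultimately show "negligible (snd c ` ((\<Union>i\<in>I. N i) \<inter> fst c))" by simp
qed

text \<open>One chart suffices to see that a subset of its domain is a null set, because transition maps are
differentiable.\<close>

lemma measure_zero_chart:
  assumes "c \<in> A" "S \<subseteq> fst c" "negligible (snd c ` S)"
  shows "measure_zero M A S"
  unfolding measure_zero_def
proof (intro conjI ballI)
  show "S \<subseteq> M" using assms(2) fst_chart_subset[OF assms(1)] by blast
  fix c' assume c': "c' \<in> A"
  have "negligible (snd c ` (S \<inter> fst c'))"
    using assms(3) by (rule negligible_subset) auto
  moreover have "(snd c' \<circ> chart_inv c) differentiable_on snd c ` (S \<inter> fst c')"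
    using transition_differentiable[OF assms(1) c'] assms(2)
    by (intro differentiable_at_imp_differentiable_on) blast
  ultimately have "negligible ((snd c' \<circ> chart_inv c) ` snd c ` (S \<inter> fst c'))"
    by (intro negligible_differentiable_image_negligible) auto
  moreover have "(snd c' \<circ> chart_inv c) ` snd c ` (S \<inter> fst c') = snd c' ` (S \<inter> fst c')"
    using chart_inverse(1)[OF assms(1)] assms(2) by (force simp: image_iff)
  ultimately show "negligible (snd c' ` (S \<inter> fst c'))" by simp
qed

lemma measure_zero_local:
  assumes "N \<subseteq> M" and local: "\<And>p. p \<in> M \<Longrightarrow> \<exists>T. open T \<and> p \<in> T \<and> measure_zero M A (N \<inter> T)"
  shows "measure_zero M A N"
proof -
  obtain T where T: "\<And>p. p \<in> M \<Longrightarrow> open (T p) \<and> p \<in> T p \<and> measure_zero M A (N \<inter> T p)"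
    using local by metis
  obtain D where D: "D \<subseteq> M" "finite D" "M \<subseteq> (\<Union>p\<in>D. T p)"
    by (rule finite_subcover[of T]) (use T in blast)+
  have "measure_zero M A (\<Union>p\<in>D. N \<inter> T p)"
    using D T by (intro measure_zero_UN) (auto simp: countable_finite)
  then show ?thesis
    by (rule measure_zero_subset) (use D(3) \<open>N \<subseteq> M\<close> in auto)
qed

text \<open>Flow lines that start in a common tame ball satisfy Gronwall's inequality backwards in its chart, so
that the positions at time \<open>h\<close>, which are confined to a null set, determine the initial values in
a Lipschitz way. A finite cover of \<open>M\<close> by such balls completes the argument.\<close>

lemma flow_preimage_measure_zero:
  assumes "admissible_step h" "measure_zero M A Z"
  shows "measure_zero M A {\<gamma> 0 |\<gamma>. flow {0..h} \<gamma> \<and> \<gamma> h \<in> Z}" (is "measure_zero M A ?N")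
proof (rule measure_zero_local)
  have "0 < h" using \<open>admissible_step h\<close> by (simp add: admissible_step_def)
  then show "?N \<subseteq> M" by (auto intro: flow_in)
  fix p assume "p \<in> M"
  then obtain c x0 r K L where tame: "tame c x0 r K L" and p: "p \<in> chart_ball c x0 (r/2)"
    and h: "K * h < r/2"
    using \<open>admissible_step h\<close> unfolding admissible_step_def by blast
  have c: "c \<in> A" using tame by (simp add: tame_def)
  obtain T where T: "open T" "chart_ball c x0 (r/2) = M \<inter> T"
    using openin_chart_ball[OF c] unfolding openin_open by blast
  define S where "S = ?N \<inter> chart_ball c x0 (r/2)"
  have "\<forall>a\<in>S. \<exists>\<gamma>. flow {0..h} \<gamma> \<and> \<gamma> 0 = a \<and> \<gamma> h \<in> Z"
    by (auto simp: S_def)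
  then obtain \<Gamma> where \<Gamma>: "\<And>a. a \<in> S \<Longrightarrow> flow {0..h} (\<Gamma> a)" "\<And>a. a \<in> S \<Longrightarrow> \<Gamma> a 0 = a" "\<And>a. a \<in> S \<Longrightarrow> \<Gamma> a h \<in> Z"
    by metis
  have stays: "\<Gamma> a t \<in> chart_ball c x0 r" if "a \<in> S" "t \<in> {0..h}" for a t
    using that \<Gamma>(1,2)[OF that(1)] by (intro flow_stays_in_chart_ball[OF tame _ _ h]) (auto simp: S_def)
  have S: "S \<subseteq> fst c" by (auto simp: S_def chart_ball_def)
  have inv: "chart_inv c (snd c a) = a" if "a \<in> S" for a
    using that S chart_inverse(1)[OF c] by blast
  have "negligible (snd c ` S)"
  proof (rule negligible_if_expanding_into_negligible)
    show "negligible (snd c ` (Z \<inter> fst c))"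
      using \<open>measure_zero M A Z\<close> c by (simp add: measure_zero_def)
    show "snd c (\<Gamma> (chart_inv c b) h) \<in> snd c ` (Z \<inter> fst c)" if "b \<in> snd c ` S" for b
      using that \<Gamma>(3) inv stays[of _ h] \<open>0 < h\<close> by (auto simp: chart_ball_def)
    fix b b' assume "b \<in> snd c ` S" "b' \<in> snd c ` S"
    then obtain a a' where a: "a \<in> S" "b = snd c a" and a': "a' \<in> S" "b' = snd c a'" by blast
    have "norm ((snd c \<circ> \<Gamma> a) 0 - (snd c \<circ> \<Gamma> a') 0)
        \<le> exp (L * h) * norm ((snd c \<circ> \<Gamma> a) h - (snd c \<circ> \<Gamma> a') h)"
    proof (rule backward_Lipschitz)
      fix t assume t: "t \<in> {0..h}"
      note in_ball = stays[OF a(1) t] stays[OF a'(1) t]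
      show "((snd c \<circ> \<Gamma> a) has_vector_derivative - grad c (snd c (\<Gamma> a t))) (at t within {0..h})"
        using in_ball by (intro flow_deriv[OF \<Gamma>(1)[OF a(1)] t c]) (simp add: chart_ball_def)
      show "((snd c \<circ> \<Gamma> a') has_vector_derivative - grad c (snd c (\<Gamma> a' t))) (at t within {0..h})"
        using in_ball by (intro flow_deriv[OF \<Gamma>(1)[OF a'(1)] t c]) (simp add: chart_ball_def)
      have "norm (grad c (snd c (\<Gamma> a t)) - grad c (snd c (\<Gamma> a' t))) \<le> L * norm (snd c (\<Gamma> a t) - snd c (\<Gamma> a' t))"
        using tame in_ball unfolding tame_def chart_ball_def by auto
      then show "norm (- grad c (snd c (\<Gamma> a t)) - - grad c (snd c (\<Gamma> a' t)))
          \<le> L * norm ((snd c \<circ> \<Gamma> a) t - (snd c \<circ> \<Gamma> a') t)"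
        by (simp add: norm_minus_commute)
    qed (use \<open>0 < h\<close> in simp)
    then show "norm (b - b') \<le> exp (L * h) *
        norm (snd c (\<Gamma> (chart_inv c b) h) - snd c (\<Gamma> (chart_inv c b') h))"
      using a a' \<Gamma>(2) inv by simp
  qed
  then have "measure_zero M A S" by (rule measure_zero_chart[OF c S])
  moreover have "?N \<inter> T = S"
    using T(2) \<open>?N \<subseteq> M\<close> by (auto simp: S_def)
  ultimately show "\<exists>T. open T \<and> p \<in> T \<and> measure_zero M A (?N \<inter> T)"
    using T p by (intro exI[of _ T]) auto
qed

text \<open>If the index is not \<open>0\<close>, then the maximum that defines it is attained at a subspace of positive
dimension in some chart \<open>c\<close>. This subspace contains a direction in which the Hessian in \<open>c\<close> is
negative, and the estimate for trapped curves applies in this same chart.\<close>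

lemma trapped_measure_zero:
  assumes "critical_point A f q" "\<not> local_minimum A f q"
  shows "\<exists>U. open U \<and> q \<in> U \<and> measure_zero M A {\<gamma> 0 |\<gamma>. flow {0..} \<gamma> \<and> (\<forall>t\<ge>0. \<gamma> t \<in> U)}"
proof -
  define D where "D = {dim W |W c. c \<in> A \<and> q \<in> fst c \<and> subspace W \<and>
     (\<forall>w\<in>W. w \<noteq> 0 \<longrightarrow> hessian f c q w w < 0)}"
  obtain c0 where c0: "c0 \<in> A" "q \<in> fst c0"
    using assms(1) by (auto simp: critical_point_def)
  have "dim {0::'e} \<in> D"
    unfolding D_def mem_Collect_eq using c0 by (intro exI[of _ "{0::'e}"] exI[of _ c0]) simp
  moreover have "D \<subseteq> {..DIM('e)}"
    by (auto simp: D_def dim_subset_UNIV)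
  ultimately have "Max D \<in> D"
    by (intro Max_in) (auto intro: finite_subset)
  moreover have "Max D \<noteq> 0"
    using assms by (simp add: local_minimum_def morse_index_def D_def)
  ultimately obtain W c where W: "dim W \<noteq> 0" and c: "c \<in> A" "q \<in> fst c"
    and neg: "\<And>w. w \<in> W \<Longrightarrow> w \<noteq> 0 \<Longrightarrow> hessian f c q w w < 0"
    unfolding D_def by (smt (verit) mem_Collect_eq)
  obtain w where w: "hessian f c q w w < 0"
    using W neg by (metis dim_eq_0 singletonI subsetI)
  interpret lg: local_gradient "coords c" "\<lambda>x. g c (chart_inv c x)" "f \<circ> chart_inv c" "grad c"
    by (rule local_gradient_chart[OF c(1)])
  have q: "snd c q \<in> coords c" by (rule chart_inverse(4)[OF c])
  have D: "lg.D (snd c q) v = differential f c q v" for v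
    by (simp add: lg.D_def differential_def)
  have H: "lg.H (snd c q) u v = hessian f c q u v" for u v
    by (simp add: lg.H_def lg.D_def hessian_def)
  have "\<forall>\<^sub>F r in at_right 0. \<forall>S. (\<forall>a\<in>S. \<exists>x. x 0 = a \<and> (\<forall>t\<ge>0. x t \<in> cball (snd c q) r \<and>
            (x has_vector_derivative - grad c (x t)) (at t within {0..}))) \<longrightarrow> negligible S"
  proof (rule lg.trapped_set_negligible[OF q])
    show "lg.D (snd c q) v = 0" for v
      using assms(1) c by (simp add: D critical_point_def)
    show "u = 0" if "\<And>v. lg.H (snd c q) u v = 0" for u
      using morse assms(1) c that unfolding H morse_function_def nondegenerate_def by blast
    show "lg.H (snd c q) w w < 0" using w by (simp add: H)
  qed
  from eventually_happens'[OF _ eventually_conj[OF eventually_at_right_less[of 0] this]]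
  obtain r where r: "0 < r" "\<And>S. (\<And>a. a \<in> S \<Longrightarrow> \<exists>x. x 0 = a \<and> (\<forall>t\<ge>0. x t \<in> cball (snd c q) r \<and>
            (x has_vector_derivative - grad c (x t)) (at t within {0..}))) \<Longrightarrow> negligible S"
    by auto
  obtain T where T: "open T" "chart_ball c (snd c q) r = M \<inter> T"
    using openin_chart_ball[OF c(1)] unfolding openin_open by blast
  let ?S = "{\<gamma> 0 |\<gamma>. flow {0..} \<gamma> \<and> (\<forall>t\<ge>0. \<gamma> t \<in> T)}"
  have in_ball: "\<gamma> t \<in> chart_ball c (snd c q) r" if "flow {0..} \<gamma>" "\<forall>t\<ge>0. \<gamma> t \<in> T" "t \<ge> 0" for \<gamma> t
    using flow_in[OF that(1)] that T(2) by auto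
  have "measure_zero M A ?S"
  proof (rule measure_zero_chart[OF c(1)])
    show "?S \<subseteq> fst c" using in_ball by (auto simp: chart_ball_def)
    show "negligible (snd c ` ?S)"
    proof (rule r(2))
      fix a assume "a \<in> snd c ` ?S"
      then obtain \<gamma> where \<gamma>: "a = snd c (\<gamma> 0)" "flow {0..} \<gamma>" "\<forall>t\<ge>0. \<gamma> t \<in> T" by blast
      have "(snd c \<circ> \<gamma>) t \<in> cball (snd c q) r" if "t \<ge> 0" for t
        using in_ball[OF \<gamma>(2,3) that] by (simp add: chart_ball_def)
      moreover have "((snd c \<circ> \<gamma>) has_vector_derivative - grad c ((snd c \<circ> \<gamma>) t)) (at t within {0..})"
        if "t \<ge> 0" for t
        using flow_deriv[OF \<gamma>(2) _ c(1)] in_ball[OF \<gamma>(2,3) that] that by (simp add: chart_ball_def)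
      ultimately show "\<exists>x. x 0 = a \<and> (\<forall>t\<ge>0. x t \<in> cball (snd c q) r \<and>
            (x has_vector_derivative - grad c (x t)) (at t within {0..}))"
        using \<gamma>(1) by (intro exI[of _ "snd c \<circ> \<gamma>"]) simp
    qed
  qed
  moreover have "q \<in> chart_ball c (snd c q) r"
    using c(2) r(1) by (simp add: chart_ball_def)
  then have "q \<in> T" unfolding T(2) by simp
  ultimately show ?thesis using T(1) by blast
qed


section \<open>Convergence of flow lines\<close>

lemma flow_f_deriv:
  assumes "flow I \<gamma>" "t \<in> I" "c \<in> A" "\<gamma> t \<in> fst c"
  shows "((f \<circ> \<gamma>) has_real_derivative
    - g c (\<gamma> t) (gradient g f c (\<gamma> t)) (gradient g f c (\<gamma> t))) (at t within I)"
proof -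
  let ?G = "gradient g f c (\<gamma> t)"
  have "((f \<circ> chart_inv c) has_derivative differential f c (\<gamma> t)) (at ((snd c \<circ> \<gamma>) t) within (snd c \<circ> \<gamma>) ` I)"
    using differential[OF assms(3,4)] by (simp add: has_derivative_at_withinI)
  from vector_derivative_diff_chain_within[OF flow_gradient[OF assms] this]
  have "((f \<circ> chart_inv c \<circ> (snd c \<circ> \<gamma>)) has_vector_derivative differential f c (\<gamma> t) (- ?G)) (at t within I)" .
  moreover have "differential f c (\<gamma> t) (- ?G) = - g c (\<gamma> t) ?G ?G"
    using gradient[OF assms(3,4), of "- ?G"] bilinear_rneg[OF metric_at(1)[OF assms(3,4)]] by simp
  ultimately have deriv: "((f \<circ> chart_inv c \<circ> (snd c \<circ> \<gamma>)) has_real_derivative - g c (\<gamma> t) ?G ?G) (at t within I)"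
    by (simp add: has_real_derivative_iff_has_vector_derivative)
  obtain T where T: "open T" "fst c = M \<inter> T"
    using chart(1)[OF assms(3)] unfolding openin_open by blast
  have "(\<gamma> \<longlongrightarrow> \<gamma> t) (at t within I)"
    using flow_continuous[OF assms(1)] assms(2) by (simp add: continuous_on_def)
  then have "\<forall>\<^sub>F s in at t within I. \<gamma> s \<in> T"
    using T assms(4) by (intro topological_tendstoD) auto
  moreover have "\<forall>\<^sub>F s in at t within I. s \<in> I"
    by (simp add: eventually_at_filter)
  ultimately have ev: "\<forall>\<^sub>F s in at t within I. (f \<circ> chart_inv c \<circ> (snd c \<circ> \<gamma>)) s = (f \<circ> \<gamma>) s"
  proof eventually_elim
    case (elim s)
    then have "\<gamma> s \<in> fst c" using T(2) flow_in[OF assms(1)] by blast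
    then show ?case using chart_inverse(1)[OF assms(3)] by simp
  qed
  show ?thesis
    using deriv unfolding has_field_derivative_def
    by (rule has_derivative_transform_eventually[OF _ ev _ assms(2)])
      (use chart_inverse(1)[OF assms(3,4)] in simp)
qed

lemma flow_f_decrease:
  assumes "flow {a..b} \<gamma>" "a \<le> b"
    and rate: "\<And>t. t \<in> {a..b} \<Longrightarrow> \<exists>c\<in>A. \<gamma> t \<in> fst c \<and> k \<le> g c (\<gamma> t) (gradient g f c (\<gamma> t)) (gradient g f c (\<gamma> t))"
  shows "f (\<gamma> b) \<le> f (\<gamma> a) - k * (b - a)"
proof -
  have "\<forall>t\<in>{a..b}. \<exists>d. ((f \<circ> \<gamma>) has_real_derivative d) (at t within {a..b}) \<and> d \<le> - k"
  proof
    fix t assume t: "t \<in> {a..b}"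
    obtain c where "c \<in> A" "\<gamma> t \<in> fst c" "k \<le> g c (\<gamma> t) (gradient g f c (\<gamma> t)) (gradient g f c (\<gamma> t))"
      using rate[OF t] by blast
    then show "\<exists>d. ((f \<circ> \<gamma>) has_real_derivative d) (at t within {a..b}) \<and> d \<le> - k"
      using flow_f_deriv[OF assms(1) t] neg_le_iff_le by blast
  qed
  then obtain d where "\<And>t. t \<in> {a..b} \<Longrightarrow> ((f \<circ> \<gamma>) has_real_derivative d t) (at t within {a..b})"
    "\<And>t. t \<in> {a..b} \<Longrightarrow> d t \<le> - k"
    by metis
  from decrease_at_rate[OF assms(2) this] show ?thesis by simp
qed

lemma flow_f_antimono:
  assumes "flow {0..} \<gamma>" "0 \<le> a" "a \<le> b"
  shows "f (\<gamma> b) \<le> f (\<gamma> a)"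
proof -
  have flow: "flow {a..b} \<gamma>" using assms by (auto intro: flow_subset)
  have "f (\<gamma> b) \<le> f (\<gamma> a) - 0 * (b - a)"
  proof (rule flow_f_decrease[OF flow assms(3)])
    fix t assume "t \<in> {a..b}"
    then obtain c where c: "c \<in> A" "\<gamma> t \<in> fst c"
      using chart_exists[OF flow_in[OF flow]] by blast
    have "0 \<le> g c (\<gamma> t) v v" for v
      using metric_at(2)[OF c, of v] bilinear_lzero[OF metric_at(1)[OF c], of v] by (cases "v = 0") auto
    then show "\<exists>c\<in>A. \<gamma> t \<in> fst c \<and> 0 \<le> g c (\<gamma> t) (gradient g f c (\<gamma> t)) (gradient g f c (\<gamma> t))"
      using c by blast
  qed
  then show ?thesis by simp
qed

lemma f_near:
  assumes "c \<in> A" "p \<in> fst c" "e > 0"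
  shows "\<exists>T. open T \<and> p \<in> T \<and> (\<forall>q\<in>M \<inter> T. q \<in> fst c \<and> \<bar>f q - f p\<bar> < e)"
proof -
  have "(f \<circ> chart_inv c) differentiable_on coords c"
    using f_smooth[OF assms(1)] unfolding smooth_on_def
    by (metis Ck_on.simps(2) differentiable_at_imp_differentiable_on)
  then have "continuous_on (coords c) (f \<circ> chart_inv c)"
    by (rule differentiable_imp_continuous_on)
  then have "open (coords c \<inter> (f \<circ> chart_inv c) -` ball (f p) e)"
    using chart(2)[OF assms(1)] by (intro continuous_open_preimage) auto
  from openin_preimage[OF assms(1) this] obtain T where
    T: "open T" "{q \<in> fst c. snd c q \<in> coords c \<inter> (f \<circ> chart_inv c) -` ball (f p) e} = M \<inter> T"
    unfolding openin_open by blast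
  moreover have "q \<in> fst c \<and> \<bar>f q - f p\<bar> < e" if "q \<in> M \<inter> T" for q
    using that chart_inverse(1)[OF assms(1)] unfolding T(2)[symmetric]
    by (auto simp: dist_real_def abs_minus_commute)
  moreover have "p \<in> M \<inter> T"
    unfolding T(2)[symmetric]
    using assms chart_inverse(1)[OF assms(1,2)] chart_inverse(4)[OF assms(1,2)] by simp
  ultimately show ?thesis by blast
qed

definition cluster_point :: "(real \<Rightarrow> 'm) \<Rightarrow> 'm \<Rightarrow> bool" where
  "cluster_point \<gamma> p \<longleftrightarrow> (\<forall>T. open T \<and> p \<in> T \<longrightarrow> (\<exists>\<^sub>F t in at_top. \<gamma> t \<in> T))"

lemma cluster_point_exists:
  assumes "compact K" "\<exists>\<^sub>F t in at_top. \<gamma> t \<in> K"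
  shows "\<exists>p\<in>K. cluster_point \<gamma> p"
proof (rule ccontr)
  assume "\<not> (\<exists>p\<in>K. cluster_point \<gamma> p)"
  then have "\<forall>p\<in>K. \<exists>T. open T \<and> p \<in> T \<and> (\<forall>\<^sub>F t in at_top. \<gamma> t \<notin> T)"
    unfolding cluster_point_def frequently_def by auto
  then obtain T where T: "\<And>p. p \<in> K \<Longrightarrow> open (T p)" "\<And>p. p \<in> K \<Longrightarrow> p \<in> T p"
    "\<And>p. p \<in> K \<Longrightarrow> \<forall>\<^sub>F t in at_top. \<gamma> t \<notin> T p"
    by metis
  have "K \<subseteq> (\<Union>p\<in>K. T p)" using T(2) by blast
  from compactE_image[OF assms(1) T(1) this] obtain D where
    D: "D \<subseteq> K" "finite D" "K \<subseteq> (\<Union>p\<in>D. T p)" by metis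
  have "\<forall>\<^sub>F t in at_top. \<forall>p\<in>D. \<gamma> t \<notin> T p"
    using D T(3) by (intro eventually_ball_finite) auto
  then have "\<forall>\<^sub>F t in at_top. \<gamma> t \<notin> K"
    by (rule eventually_mono) (use D(3) in blast)
  then show False using assms(2) by (simp add: frequently_def)
qed

lemma frequently_at_top_obtain:
  fixes a :: real
  assumes "\<exists>\<^sub>F t in at_top. P t"
  obtains t where "a \<le> t" "P t"
  using frequently_eventually_frequently[OF assms eventually_ge_at_top[of a]]
  by (metis (mono_tags, lifting) frequently_ex)

text \<open>Suppose that \<open>p\<close> is not critical. By monotonicity, \<open>f\<close> stays at or above \<open>f p\<close> along the flow line.
But each time the flow line comes close to \<open>p\<close> it spends at least time \<open>h\<close> in a ball where \<open>f\<close>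
decreases at rate at least \<open>\<delta>\<close>; if it comes so close that \<open>f\<close> is below \<open>f p + \<delta> h\<close>, then
afterwards \<open>f\<close> is below \<open>f p\<close>.\<close>

lemma cluster_point_critical:
  assumes flow: "flow {0..} \<gamma>" and "p \<in> M" and cluster: "cluster_point \<gamma> p"
  shows "critical_point A f p"
proof (rule ccontr)
  assume "\<not> critical_point A f p"
  then obtain c v where c: "c \<in> A" "p \<in> fst c" and "differential f c p v \<noteq> 0"
    using chart_exists[OF \<open>p \<in> M\<close>] by (auto simp: critical_point_def)
  interpret lg: local_gradient "coords c" "\<lambda>x. g c (chart_inv c x)" "f \<circ> chart_inv c" "grad c"
    by (rule local_gradient_chart[OF c(1)])
  define x0 where "x0 = snd c p"
  have x0: "x0 \<in> coords c" unfolding x0_def by (rule chart_inverse(4)[OF c])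
  have "grad c x0 \<noteq> 0"
    using gradient[OF c, of v] \<open>differential f c p v \<noteq> 0\<close> bilinear_lzero[OF metric_at(1)[OF c]] c
    by (auto simp: x0_def grad_at)
  then have nz: "norm (grad c x0) > 0" by simp
  obtain m C where m: "m > 0" "\<forall>\<^sub>F r in at_right 0. \<forall>x\<in>cball x0 r. \<forall>u v.
           m * (norm u)\<^sup>2 \<le> g c (chart_inv c x) u u \<and> \<bar>g c (chart_inv c x) u v\<bar> \<le> C * norm u * norm v"
    using lg.metric_coercive[OF x0] by blast
  obtain K L where KL: "\<forall>\<^sub>F r in at_right 0. tame c x0 r K L"
    using tame_exists[OF c] unfolding x0_def by blast
  define N where "N = \<bar>L\<bar> + 1"
  have "N > 0" by (simp add: N_def)
  \<comment> \<open>Within this radius the Lipschitz bound leaves at least half of the gradient at \<open>x0\<close>.\<close>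
  define r0 where "r0 = norm (grad c x0) / (2 * N)"
  have "r0 > 0" using nz \<open>N > 0\<close> by (simp add: r0_def)
  then have "\<forall>\<^sub>F r in at_right 0. r < r0"
    unfolding eventually_at_right_field by (intro exI[of _ r0]) auto
  from eventually_happens'[OF _ eventually_conj[OF eventually_conj[OF m(2) KL] this]]
  obtain r where r: "r < r0" "tame c x0 r K L"
    and coercive: "\<And>x u. x \<in> cball x0 r \<Longrightarrow> m * (norm u)\<^sup>2 \<le> g c (chart_inv c x) u u"
    by auto
  have pos: "0 < r" "0 \<le> K" "0 \<le> L" using r(2) by (auto simp: tame_def)
  define \<delta> where "\<delta> = m * (norm (grad c x0) / 2)\<^sup>2"
  have "\<delta> > 0" using m(1) nz by (simp add: \<delta>_def)
  have steep: "\<delta> \<le> g c q (gradient g f c q) (gradient g f c q)" if "q \<in> chart_ball c x0 r" for q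
  proof -
    have q: "q \<in> fst c" "snd c q \<in> cball x0 r" using that by (auto simp: chart_ball_def)
    have "norm (grad c x0 - grad c (snd c q)) \<le> L * norm (x0 - snd c q)"
      using r(2) q(2) pos(1) unfolding tame_def by auto
    also have "\<dots> \<le> L * r0"
      using q(2) r(1) pos(3) by (intro mult_left_mono) (auto simp: dist_norm)
    also have "\<dots> \<le> N * r0"
      using \<open>r0 > 0\<close> by (intro mult_right_mono) (auto simp: N_def)
    also have "\<dots> = norm (grad c x0) / 2"
      using \<open>N > 0\<close> by (simp add: r0_def)
    finally have "norm (grad c x0) / 2 \<le> norm (grad c (snd c q))"
      using norm_triangle_ineq2[of "grad c x0" "grad c (snd c q)"] by linarith
    then have "\<delta> \<le> m * (norm (grad c (snd c q)))\<^sup>2"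
      unfolding \<delta>_def using m(1) by (intro mult_left_mono power_mono) auto
    also have "\<dots> \<le> g c q (gradient g f c q) (gradient g f c q)"
      using coercive[OF q(2), of "grad c (snd c q)"] chart_inverse(1)[OF c(1) q(1)] grad_at[OF c(1) q(1)] by simp
    finally show ?thesis .
  qed
  define h where "h = r / (4 * (K + 1))"
  have "h > 0" using pos by (simp add: h_def)
  have "h * (4 * (K + 1)) = r" using pos by (simp add: h_def)
  then have Kh: "K * h < r / 2"
    using \<open>h > 0\<close> mult_nonneg_nonneg[OF pos(2), of h] by (simp add: algebra_simps)
  have lower: "f p \<le> f (\<gamma> t)" if "t \<ge> 0" for t
  proof (rule ccontr)
    assume "\<not> f p \<le> f (\<gamma> t)"
    then obtain T where T: "open T" "p \<in> T" "\<And>q. q \<in> M \<inter> T \<Longrightarrow> \<bar>f q - f p\<bar> < f p - f (\<gamma> t)"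
      using f_near[OF c, of "f p - f (\<gamma> t)"] by auto
    then obtain t' where t': "t \<le> t'" "\<gamma> t' \<in> T"
      using cluster frequently_at_top_obtain unfolding cluster_point_def by metis
    have "f (\<gamma> t') \<le> f (\<gamma> t)" using flow_f_antimono[OF flow that t'(1)] .
    moreover have "\<bar>f (\<gamma> t') - f p\<bar> < f p - f (\<gamma> t)"
      using T(3)[of "\<gamma> t'"] t' that flow_in[OF flow, of t'] by simp
    ultimately show False by linarith
  qed
  have "\<delta> * h > 0" using \<open>\<delta> > 0\<close> \<open>h > 0\<close> by simp
  then obtain T where T: "open T" "p \<in> T" "\<And>q. q \<in> M \<inter> T \<Longrightarrow> \<bar>f q - f p\<bar> < \<delta> * h"
    using f_near[OF c] by meson
  obtain T' where T': "open T'" "chart_ball c x0 (r/2) = M \<inter> T'"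
    using openin_chart_ball[OF c(1)] unfolding openin_open by blast
  have "p \<in> chart_ball c x0 (r/2)" using c pos(1) by (simp add: chart_ball_def x0_def)
  then have "open (T \<inter> T')" "p \<in> T \<inter> T'" using T T' by auto
  then obtain t where t: "0 \<le> t" "\<gamma> t \<in> T \<inter> T'"
    using cluster frequently_at_top_obtain unfolding cluster_point_def by metis
  have flow': "flow {0..h} (\<lambda>s. \<gamma> (s + t))"
    using t(1) by (intro flow_shift[OF flow]) auto
  have start: "\<gamma> (0 + t) \<in> chart_ball c x0 (r/2)"
    unfolding T'(2) using t flow_in[OF flow, of t] by simp
  have "f (\<gamma> (h + t)) \<le> f (\<gamma> (0 + t)) - \<delta> * (h - 0)"
  proof (rule flow_f_decrease[OF flow'])
    show "0 \<le> h" using \<open>h > 0\<close> by simp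
    fix s assume s: "s \<in> {0..h}"
    have "\<gamma> (s + t) \<in> chart_ball c x0 r"
      using flow_stays_in_chart_ball[OF r(2) flow' start Kh s] .
    then show "\<exists>c\<in>A. \<gamma> (s + t) \<in> fst c \<and>
        \<delta> \<le> g c (\<gamma> (s + t)) (gradient g f c (\<gamma> (s + t))) (gradient g f c (\<gamma> (s + t)))"
      using c(1) steep by (auto simp: chart_ball_def)
  qed
  moreover have "f (\<gamma> t) < f p + \<delta> * h"
    using T(3)[of "\<gamma> t"] t flow_in[OF flow, of t] by auto
  ultimately show False using lower[of "h + t"] t(1) \<open>h > 0\<close> by simp
qed

text \<open>At a critical point two zeros of the gradient coincide by the expansion estimate; elsewhere the
gradient is non-zero in a whole neighbourhood. The second case is included so that these
neighbourhoods cover \<open>M\<close>, which makes the number of critical points finite by compactness.\<close>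

lemma critical_isolated:
  assumes "p \<in> M"
  shows "\<exists>T. open T \<and> p \<in> T \<and> (\<forall>q\<in>M \<inter> T. critical_point A f q \<longrightarrow> q = p)"
proof -
  have "\<exists>c r. c \<in> A \<and> p \<in> fst c \<and> 0 < r \<and>
      (\<forall>q\<in>fst c. snd c q \<in> cball (snd c p) r \<longrightarrow> critical_point A f q \<longrightarrow> q = p)"
  proof (cases "critical_point A f p")
    case True
    obtain c where c: "c \<in> A" "p \<in> fst c" using chart_exists[OF assms] by blast
    interpret lg: local_gradient "coords c" "\<lambda>x. g c (chart_inv c x)" "f \<circ> chart_inv c" "grad c"
      by (rule local_gradient_chart[OF c(1)])
    have x0: "snd c p \<in> coords c" by (rule chart_inverse(4)[OF c])
    have H: "lg.H (snd c p) u v = hessian f c p u v" for u v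
      by (simp add: lg.H_def lg.D_def hessian_def)
    have "\<exists>k>0. \<forall>\<^sub>F r in at_right 0. \<forall>x\<in>cball (snd c p) r. \<forall>y\<in>cball (snd c p) r.
           k * (norm (x - y))\<^sup>2 \<le> lg.H (snd c p) (grad c x - grad c y) (x - y)"
    proof (rule lg.hessian_expands[OF x0])
      show "lg.D (snd c p) v = 0" for v
        using True c by (simp add: lg.D_def critical_point_def differential_def)
      show "u = 0" if "\<And>v. lg.H (snd c p) u v = 0" for u
        using morse True c that unfolding H morse_function_def nondegenerate_def by blast
    qed
    then obtain k where k: "k > 0" "\<forall>\<^sub>F r in at_right 0. \<forall>x\<in>cball (snd c p) r. \<forall>y\<in>cball (snd c p) r.
           k * (norm (x - y))\<^sup>2 \<le> lg.H (snd c p) (grad c x - grad c y) (x - y)" by blast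
    from eventually_happens'[OF _ eventually_conj[OF eventually_at_right_less[of 0] k(2)]]
    obtain r where r: "0 < r" "\<And>x y. x \<in> cball (snd c p) r \<Longrightarrow> y \<in> cball (snd c p) r \<Longrightarrow>
           k * (norm (x - y))\<^sup>2 \<le> lg.H (snd c p) (grad c x - grad c y) (x - y)" by auto
    have "q = p" if q: "q \<in> fst c" "snd c q \<in> cball (snd c p) r" "critical_point A f q" for q
    proof -
      have "grad c (snd c q) = 0" "grad c (snd c p) = 0"
        using q(3) True c q(1) metric_at(1)[OF c(1)]
        by (auto simp: grad_at critical_point_def bilinear_lzero intro!: gradient_unique)
      then have "k * (norm (snd c q - snd c p))\<^sup>2 \<le> 0"
        using r(2)[OF q(2), of "snd c p"] r(1) bilinear_lzero[OF lg.bilinear_H[OF x0]] by simp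
      then have "snd c q = snd c p" using k(1) by (simp add: mult_le_0_iff)
      then show ?thesis using chart_inverse(1)[OF c(1)] q(1) c(2) by metis
    qed
    then show ?thesis using c r(1) by blast
  next
    case False
    then obtain c v where c: "c \<in> A" "p \<in> fst c" and "differential f c p v \<noteq> 0"
      using chart_exists[OF \<open>p \<in> M\<close>] by (auto simp: critical_point_def)
    then have nz: "norm (grad c (snd c p)) > 0"
      using gradient[OF c, of v] bilinear_lzero[OF metric_at(1)[OF c]] by (auto simp: grad_at)
    obtain K L where KL: "\<forall>\<^sub>F r in at_right 0. tame c (snd c p) r K L"
      using tame_exists[OF c] by blast
    define N where "N = \<bar>L\<bar> + 1"
    have "N > 0" by (simp add: N_def)
    define r0 where "r0 = norm (grad c (snd c p)) / N"
    have "r0 > 0" using nz \<open>N > 0\<close> by (simp add: r0_def)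
    then have "\<forall>\<^sub>F r in at_right 0. r < r0"
      unfolding eventually_at_right_field by (intro exI[of _ r0]) auto
    from eventually_happens'[OF _ eventually_conj[OF this KL]]
    obtain r where r: "r < r0" "tame c (snd c p) r K L" by auto
    then have pos: "0 < r" "0 \<le> L" by (auto simp: tame_def)
    have "\<not> critical_point A f q" if q: "q \<in> fst c" "snd c q \<in> cball (snd c p) r" for q
    proof
      assume "critical_point A f q"
      then have "grad c (snd c q) = 0"
        using c q(1) metric_at(1)[OF c(1)]
        by (auto simp: grad_at critical_point_def bilinear_lzero intro!: gradient_unique)
      then have "norm (grad c (snd c p)) \<le> L * norm (snd c p - snd c q)"
        using r(2) q(2) pos(1) unfolding tame_def
        by (metis centre_in_cball diff_zero less_imp_le)
      also have "\<dots> \<le> L * r"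
        using q(2) pos(2) by (intro mult_left_mono) (auto simp: dist_norm)
      also have "\<dots> < N * r0"
        using r(1) pos by (intro mult_less_le_imp_less) (auto simp: N_def)
      finally show False using \<open>N > 0\<close> by (simp add: r0_def)
    qed
    then show ?thesis using c pos(1) by blast
  qed
  then obtain c r where c: "c \<in> A" "p \<in> fst c" "0 < r" and
    iso: "\<And>q. q \<in> fst c \<Longrightarrow> snd c q \<in> cball (snd c p) r \<Longrightarrow> critical_point A f q \<Longrightarrow> q = p"
    by blast
  obtain T where T: "open T" "chart_ball c (snd c p) r = M \<inter> T"
    using openin_chart_ball[OF c(1)] unfolding openin_open by blast
  have "p \<in> M \<inter> T" unfolding T(2)[symmetric] using c by (simp add: chart_ball_def)
  moreover have "q = p" if "q \<in> M \<inter> T" "critical_point A f q" for q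
    using that iso[of q] unfolding T(2)[symmetric] by (simp add: chart_ball_def)
  ultimately show ?thesis using T(1) by blast
qed

lemma finite_critical: "finite {p. critical_point A f p}"
proof -
  obtain T where T: "\<And>p. p \<in> M \<Longrightarrow> open (T p)" "\<And>p. p \<in> M \<Longrightarrow> p \<in> T p"
    "\<And>p q. p \<in> M \<Longrightarrow> q \<in> M \<inter> T p \<Longrightarrow> critical_point A f q \<Longrightarrow> q = p"
    using critical_isolated by metis
  obtain D where D: "D \<subseteq> M" "finite D" "M \<subseteq> (\<Union>p\<in>D. T p)"
    by (rule finite_subcover[of T]) (use T in blast)+
  have "p \<in> D" if "critical_point A f p" for p
  proof -
    have "p \<in> M" using that fst_chart_subset by (auto simp: critical_point_def)
    then obtain q where "q \<in> D" "p \<in> T q" using D(3) by blast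
    then show ?thesis using T(3)[of q p] D(1) \<open>p \<in> M\<close> that by blast
  qed
  then show ?thesis using D(2) by (auto intro: finite_subset)
qed


text \<open>Let \<open>q\<close> be a cluster point. In a small ball around \<open>q\<close> it is the only critical point. If the flow
line did not stay in this ball eventually, then it would commute forever between the ball of half
the radius and the outside, hence by connectedness visit the compact annulus in between at
arbitrarily late times. It would have a cluster point there, which would be critical.\<close>

lemma flow_converges:
  assumes flow: "flow {0..} \<gamma>"
  shows "\<exists>q. critical_point A f q \<and> (\<gamma> \<longlongrightarrow> q) at_top"
proof -
  have "\<forall>\<^sub>F t in at_top. \<gamma> t \<in> M"
    using eventually_ge_at_top[of 0] by (rule eventually_mono) (auto intro: flow_in[OF flow])
  then have "\<exists>\<^sub>F t in at_top. \<gamma> t \<in> M"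
    by (intro eventually_frequently) auto
  then obtain q where q: "q \<in> M" "cluster_point \<gamma> q"
    using cluster_point_exists[OF compact_M] by blast
  have crit: "critical_point A f q" by (rule cluster_point_critical[OF flow q])
  obtain T where T: "open T" "q \<in> T" and iso: "\<And>p. p \<in> M \<inter> T \<Longrightarrow> critical_point A f p \<Longrightarrow> p = q"
    using critical_isolated[OF q(1)] by blast
  obtain c where c: "c \<in> A" "q \<in> fst c" using chart_exists[OF q(1)] by blast
  let ?x = "snd c q"
  have "(\<gamma> \<longlongrightarrow> q) at_top"
  proof (rule topological_tendstoI)
    fix U assume U: "open U" "q \<in> U"
    have "openin (top_of_set M) (fst c \<inter> (T \<inter> U))"
      using chart(1)[OF c(1)] T(1) U(1) by (intro openin_Int_open) auto
    then have "open (snd c ` (fst c \<inter> (T \<inter> U)))"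
      by (intro open_image_chart[OF c(1)]) auto
    moreover have "?x \<in> snd c ` (fst c \<inter> (T \<inter> U))" using c T(2) U(2) by blast
    ultimately obtain r where r: "0 < r" "cball ?x r \<subseteq> snd c ` (fst c \<inter> (T \<inter> U))"
      by (meson open_contains_cball)
    have in_TU: "p \<in> T \<inter> U" if "p \<in> fst c" "snd c p \<in> cball ?x r" for p
    proof -
      obtain p' where "p' \<in> fst c" "p' \<in> T \<inter> U" "snd c p = snd c p'"
        using r(2) \<open>snd c p \<in> cball ?x r\<close> by blast
      then show ?thesis using chart_inverse(1)[OF c(1)] \<open>p \<in> fst c\<close> by metis
    qed
    have coords: "cball ?x r \<subseteq> coords c" using r(2) by (auto simp: coords_def)
    define C where "C = {p \<in> fst c. snd c p \<in> cball ?x r}"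
    define K where "K = {p \<in> fst c. snd c p \<in> cball ?x r - ball ?x (r/2)}"
    have "compact C" unfolding C_def using coords by (intro compact_preimage[OF c(1)]) auto
    have "compact K"
      unfolding K_def using coords by (intro compact_preimage[OF c(1)] compact_diff) auto
    have "\<forall>\<^sub>F t in at_top. \<gamma> t \<in> C"
    proof (rule ccontr)
      assume "\<not> (\<forall>\<^sub>F t in at_top. \<gamma> t \<in> C)"
      then have outside: "\<exists>\<^sub>F t in at_top. \<gamma> t \<notin> C" by (simp add: frequently_def)
      obtain T1 where T1: "open T1" "chart_ball c ?x (r/2) = M \<inter> T1"
        using openin_chart_ball[OF c(1)] unfolding openin_open by blast
      have "q \<in> chart_ball c ?x (r/2)" using c r(1) by (simp add: chart_ball_def)
      then have "q \<in> T1" unfolding T1(2) by simp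
      then have inside: "\<exists>\<^sub>F t in at_top. \<gamma> t \<in> T1"
        using q(2) T1(1) unfolding cluster_point_def by blast
      have "\<exists>t\<ge>N. \<gamma> t \<in> K" for N
      proof (rule ccontr)
        assume no: "\<not> (\<exists>t\<ge>N. \<gamma> t \<in> K)"
        obtain t1 where t1: "max 0 N \<le> t1" "\<gamma> t1 \<in> T1"
          using frequently_at_top_obtain[OF inside] by metis
        obtain t2 where t2: "t1 \<le> t2" "\<gamma> t2 \<notin> C"
          using frequently_at_top_obtain[OF outside] by metis
        have "continuous_on {t1..t2} \<gamma>"
          using flow_continuous[OF flow] by (rule continuous_on_subset) (use t1 in auto)
        then have conn: "connected (\<gamma> ` {t1..t2})"
          by (rule connected_continuous_image) simp
        have M: "\<gamma> t \<in> M" if "t \<in> {t1..t2}" for t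
          using flow_in[OF flow, of t] that t1(1) by auto
        have "open (- C)" using \<open>compact C\<close> by (simp add: compact_imp_closed open_Compl)
        moreover have "T1 \<inter> - C \<inter> \<gamma> ` {t1..t2} = {}"
        proof -
          have "p \<in> C" if "p \<in> M \<inter> T1" for p
            using that r(1) unfolding T1(2)[symmetric] C_def chart_ball_def by auto
          then show ?thesis using M by blast
        qed
        moreover have "\<gamma> ` {t1..t2} \<subseteq> T1 \<union> - C"
        proof
          fix p assume "p \<in> \<gamma> ` {t1..t2}"
          then obtain t where t: "t \<in> {t1..t2}" "p = \<gamma> t" by blast
          then have "p \<notin> K" using no t1(1) by auto
          then have "p \<in> chart_ball c ?x (r/2) \<or> p \<notin> C"
            by (auto simp: K_def C_def chart_ball_def)
          then show "p \<in> T1 \<union> - C" unfolding T1(2) by blast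
        qed
        moreover have "T1 \<inter> \<gamma> ` {t1..t2} \<noteq> {}" "- C \<inter> \<gamma> ` {t1..t2} \<noteq> {}"
          using t1(2) t2 by auto
        ultimately show False
          using conn T1(1) unfolding connected_def by blast
      qed
      then have "\<exists>\<^sub>F t in at_top. \<gamma> t \<in> K"
        unfolding frequently_def eventually_at_top_linorder by blast
      then obtain p where p: "p \<in> K" "cluster_point \<gamma> p"
        using cluster_point_exists[OF \<open>compact K\<close>] by blast
      have "p \<in> fst c" "snd c p \<in> cball ?x r" "snd c p \<notin> ball ?x (r/2)"
        using p(1) by (auto simp: K_def)
      then have "p \<in> M \<inter> T" using in_TU fst_chart_subset[OF c(1)] by blast
      then have "p = q"
        using iso cluster_point_critical[OF flow _ p(2)] by blast
      then show False using \<open>snd c p \<notin> ball ?x (r/2)\<close> r(1) by simp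
    qed
    then show "\<forall>\<^sub>F t in at_top. \<gamma> t \<in> U"
      by (rule eventually_mono) (use in_TU in \<open>auto simp: C_def\<close>)
  qed
  then show ?thesis using crit by blast
qed

section \<open>Global flow lines and stable sets\<close>

lemma flow_extend:
  assumes "admissible_step h" "flow {-a..a} \<gamma>" "0 \<le> a"
  shows "\<exists>\<delta>. flow {-(a + h)..a + h} \<delta> \<and> (\<forall>t\<in>{-a..a}. \<delta> t = \<gamma> t)"
proof -
  have "h > 0" using assms(1) by (simp add: admissible_step_def)
  have start: "\<exists>\<sigma>. flow {-h..h} \<sigma> \<and> \<sigma> 0 = p" if "p \<in> M" for p
    using assms(1) that flow_locally_exists unfolding admissible_step_def by meson
  have "\<gamma> a \<in> M" "\<gamma> (-a) \<in> M" using flow_in[OF assms(2)] assms(3) by auto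
  then obtain \<sigma> \<rho> where \<sigma>: "flow {-h..h} \<sigma>" "\<sigma> 0 = \<gamma> a" and \<rho>: "flow {-h..h} \<rho>" "\<rho> 0 = \<gamma> (-a)"
    using start by meson
  have right: "flow {a..a + h} (\<lambda>t. \<sigma> (t + - a))"
    by (rule flow_shift[OF \<sigma>(1)]) (use \<open>h > 0\<close> in auto)
  have left: "flow {-(a + h)..-a} (\<lambda>t. \<rho> (t + a))"
    by (rule flow_shift[OF \<rho>(1)]) (use \<open>h > 0\<close> in auto)
  define \<gamma>' where "\<gamma>' t = (if t \<le> a then \<gamma> t else \<sigma> (t + - a))" for t
  have extended: "flow {-a..a + h} \<gamma>'"
    unfolding \<gamma>'_def using assms(3) \<open>h > 0\<close> \<sigma>(2) by (intro flow_join[OF assms(2) right]) auto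
  have "\<rho> (-a + a) = \<gamma>' (-a)" using assms(3) \<rho>(2) by (simp add: \<gamma>'_def)
  then have "flow {-(a + h)..a + h} (\<lambda>t. if t \<le> -a then \<rho> (t + a) else \<gamma>' t)"
    using assms(3) \<open>h > 0\<close> by (intro flow_join[OF left extended]) auto
  moreover have "(if t \<le> -a then \<rho> (t + a) else \<gamma>' t) = \<gamma> t" if "t \<in> {-a..a}" for t
    using that \<rho>(2) by (cases "t = -a") (auto simp: \<gamma>'_def)
  ultimately show ?thesis by blast
qed

text \<open>Prolonging a flow line by the fixed length \<open>h\<close> at both ends, again and again, gives a sequence of
flow lines, each of which extends the previous one, so that their union is a flow line.\<close>

lemma flow_exists:
  assumes "p \<in> M"
  shows "\<exists>\<gamma>. flow UNIV \<gamma> \<and> \<gamma> 0 = p"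
proof -
  obtain h where h: "admissible_step h" using admissible_step_exists by blast
  then have "h > 0" by (simp add: admissible_step_def)
  define a where "a n = real (Suc n) * h" for n
  have a_pos: "a n > 0" for n using \<open>h > 0\<close> by (simp add: a_def)
  have a_Suc: "a (Suc n) = a n + h" for n by (simp add: a_def algebra_simps)
  have "\<exists>\<gamma>. \<forall>n. (flow {-a n..a n} (\<gamma> n) \<and> \<gamma> n 0 = p) \<and> (\<forall>t\<in>{-a n..a n}. \<gamma> (Suc n) t = \<gamma> n t)"
  proof (rule dependent_nat_choice)
    show "\<exists>\<gamma>. flow {-a 0..a 0} \<gamma> \<and> \<gamma> 0 = p"
      using h assms flow_locally_exists unfolding admissible_step_def a_def by simp meson
    fix \<gamma> n assume \<gamma>: "flow {-a n..a n} \<gamma> \<and> \<gamma> 0 = p"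
    then obtain \<delta> where "flow {-a (Suc n)..a (Suc n)} \<delta>" "\<forall>t\<in>{-a n..a n}. \<delta> t = \<gamma> t"
      using flow_extend[OF h, of "a n" \<gamma>] a_pos[of n] unfolding a_Suc by auto
    moreover from this have "\<delta> 0 = p" using \<gamma> a_pos[of n] by simp
    ultimately show "\<exists>\<delta>. (flow {-a (Suc n)..a (Suc n)} \<delta> \<and> \<delta> 0 = p) \<and> (\<forall>t\<in>{-a n..a n}. \<delta> t = \<gamma> t)"
      by blast
  qed
  then obtain \<gamma> where \<gamma>: "\<And>n. flow {-a n..a n} (\<gamma> n)" "\<And>n. \<gamma> n 0 = p"
    "\<And>n t. t \<in> {-a n..a n} \<Longrightarrow> \<gamma> (Suc n) t = \<gamma> n t"
    by blast
  have mono: "a m \<le> a n" if "m \<le> n" for m n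
    using that \<open>h > 0\<close> by (simp add: a_def mult_right_mono)
  have agree: "\<gamma> n t = \<gamma> m t" if "m \<le> n" "t \<in> {-a m..a m}" for m n t
    using that(1)
  proof (induction n rule: dec_induct)
    case (step n)
    then have "t \<in> {-a n..a n}" using mono[of m n] that(2) by auto
    then show ?case using \<gamma>(3) step.IH by simp
  qed simp
  have ex: "\<exists>n. \<bar>t\<bar> < a n" for t
  proof -
    obtain n where "\<bar>t\<bar> / h < real n" using reals_Archimedean2 by blast
    then have "\<bar>t\<bar> < real n * h" using \<open>h > 0\<close> by (simp add: pos_divide_less_eq)
    also have "\<dots> \<le> a n" using \<open>h > 0\<close> by (simp add: a_def)
    finally show ?thesis by blast
  qed
  define \<Gamma> where "\<Gamma> t = \<gamma> (LEAST n. \<bar>t\<bar> < a n) t" for t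
  have \<Gamma>: "\<Gamma> t = \<gamma> n t" if "\<bar>t\<bar> < a n" for t n
  proof -
    have "(LEAST n. \<bar>t\<bar> < a n) \<le> n" using that by (rule Least_le)
    moreover have "\<bar>t\<bar> < a (LEAST n. \<bar>t\<bar> < a n)" using ex by (rule LeastI_ex)
    ultimately show ?thesis unfolding \<Gamma>_def by (intro agree[symmetric]) auto
  qed
  have "flow UNIV \<Gamma>"
    unfolding flow_def
  proof (intro conjI ballI impI)
    have interior: "open {-a n<..<a n}" "\<And>s. s \<in> {-a n<..<a n} \<Longrightarrow> \<gamma> n s = \<Gamma> s"
      "flow {-a n<..<a n} (\<gamma> n)" for n
      using \<Gamma>[of _ n] flow_subset[OF \<gamma>(1)[of n] greaterThanLessThan_subseteq_atLeastAtMost_iff[THEN iffD2]]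
      by auto
    have "isCont \<Gamma> t" for t
    proof -
      obtain n where n: "\<bar>t\<bar> < a n" using ex by blast
      have "continuous_on {-a n<..<a n} \<Gamma>"
        using flow_continuous[OF interior(3)[of n]] interior(2)[of _ n]
          continuous_on_cong[of _ "{-a n<..<a n}" \<Gamma> "\<gamma> n"] by metis
      moreover have "t \<in> {-a n<..<a n}" using n by auto
      ultimately show ?thesis using interior(1)[of n] continuous_on_eq_continuous_at by blast
    qed
    then show "continuous_on UNIV \<Gamma>" by (simp add: continuous_at_imp_continuous_on)
    show "range \<Gamma> \<subseteq> M"
      using ex \<Gamma> flow_in[OF \<gamma>(1)] by (smt (verit) atLeastAtMost_iff image_subset_iff)
    fix t c assume c: "c \<in> A" "\<Gamma> t \<in> fst c"
    obtain n where n: "\<bar>t\<bar> < a n" using ex by blast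
    then have t: "t \<in> {-a n<..<a n}" by auto
    have "\<gamma> n t \<in> fst c" using c(2) interior(2)[OF t] by simp
    from flow_gradient[OF interior(3) t c(1) this]
    have "((snd c \<circ> \<gamma> n) has_vector_derivative - gradient g f c (\<gamma> n t)) (at t)"
      using t interior(1) at_within_open by metis
    then have "((snd c \<circ> \<Gamma>) has_vector_derivative - gradient g f c (\<gamma> n t)) (at t)"
      by (rule has_vector_derivative_transform_within_open[OF _ interior(1)[of n] t])
        (simp add: interior(2))
    then show "((snd c \<circ> \<Gamma>) has_vector_derivative - gradient g f c (\<Gamma> t)) (at t)"
      using interior(2)[OF t] by simp
  qed
  moreover have "\<Gamma> 0 = p" using \<Gamma>[of 0 0] \<gamma>(2) a_pos[of 0] by simp
  ultimately show ?thesis by blast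
qed

text \<open>\<open>Z n\<close> consists of the initial values that are trapped near \<open>q\<close> after \<open>n\<close> time steps. The set
\<open>Z 0\<close> is null by the local analysis, and each \<open>Z (Suc n)\<close> is contained in the preimage of \<open>Z n\<close>
under one time step of the flow.\<close>

lemma stable_set_measure_zero:
  assumes "critical_point A f q" "\<not> local_minimum A f q"
  shows "measure_zero M A {\<gamma> 0 |\<gamma>. flow {0..} \<gamma> \<and> (\<gamma> \<longlongrightarrow> q) at_top}"
proof -
  obtain U where U: "open U" "q \<in> U"
    and null: "measure_zero M A {\<gamma> 0 |\<gamma>. flow {0..} \<gamma> \<and> (\<forall>t\<ge>0. \<gamma> t \<in> U)}"
    using trapped_measure_zero[OF assms] by blast
  obtain h where h: "admissible_step h" using admissible_step_exists by blast
  then have "h > 0" by (simp add: admissible_step_def)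
  define Z where "Z n = {\<gamma> 0 |\<gamma>. flow {0..} \<gamma> \<and> (\<forall>t\<ge>real n * h. \<gamma> t \<in> U)}" for n
  have Z: "measure_zero M A (Z n)" for n
  proof (induction n)
    case 0
    then show ?case using null by (simp add: Z_def)
  next
    case (Suc n)
    have "Z (Suc n) \<subseteq> {\<gamma> 0 |\<gamma>. flow {0..h} \<gamma> \<and> \<gamma> h \<in> Z n}"
    proof
      fix p assume "p \<in> Z (Suc n)"
      then obtain \<gamma> where \<gamma>: "p = \<gamma> 0" "flow {0..} \<gamma>" "\<And>t. t \<ge> real (Suc n) * h \<Longrightarrow> \<gamma> t \<in> U"
        unfolding Z_def by blast
      have "flow {0..} (\<lambda>t. \<gamma> (t + h))"
        by (rule flow_shift[OF \<gamma>(2)]) (use \<open>h > 0\<close> in auto)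
      moreover have "\<gamma> (t + h) \<in> U" if "t \<ge> real n * h" for t
        using that by (intro \<gamma>(3)) (simp add: algebra_simps)
      ultimately have "\<gamma> (0 + h) \<in> Z n"
        unfolding Z_def mem_Collect_eq by (intro exI[of _ "\<lambda>t. \<gamma> (t + h)"]) simp
      moreover have "flow {0..h} \<gamma>"
        by (rule flow_subset[OF \<gamma>(2)]) auto
      ultimately show "p \<in> {\<gamma> 0 |\<gamma>. flow {0..h} \<gamma> \<and> \<gamma> h \<in> Z n}"
        using \<gamma>(1) by auto
    qed
    then show ?case
      by (rule measure_zero_subset[OF flow_preimage_measure_zero[OF h Suc]])
  qed
  have "{\<gamma> 0 |\<gamma>. flow {0..} \<gamma> \<and> (\<gamma> \<longlongrightarrow> q) at_top} \<subseteq> (\<Union>n. Z n)"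
  proof
    fix p assume "p \<in> {\<gamma> 0 |\<gamma>. flow {0..} \<gamma> \<and> (\<gamma> \<longlongrightarrow> q) at_top}"
    then obtain \<gamma> where \<gamma>: "p = \<gamma> 0" "flow {0..} \<gamma>" "(\<gamma> \<longlongrightarrow> q) at_top" by blast
    obtain N where N: "\<And>t. t \<ge> N \<Longrightarrow> \<gamma> t \<in> U"
      using topological_tendstoD[OF \<gamma>(3) U] unfolding eventually_at_top_linorder by blast
    obtain n where "N / h < real n" using reals_Archimedean2 by blast
    then have "N \<le> real n * h" using \<open>h > 0\<close> by (simp add: pos_divide_less_eq)
    then have "p \<in> Z n"
      unfolding Z_def using \<gamma>(1,2) N by (auto intro!: exI[of _ \<gamma>])
    then show "p \<in> (\<Union>n. Z n)" by blast
  qed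
  moreover have "measure_zero M A (\<Union>n. Z n)"
    using Z by (intro measure_zero_UN) auto
  ultimately show ?thesis by (rule measure_zero_subset[rotated])
qed

end

theorem corollary3p3:
  fixes M :: "'m::t2_space set"
    and A :: "('m, 'e::euclidean_space) chart set"
    and g :: "('m, 'e) metric_field"
    and f :: "'m \<Rightarrow> real"
  assumes "smooth_manifold M A"
    and "compact M"
    and "riemannian_metric A g"
    and "morse_function A f"
  shows "\<exists>N. measure_zero M A N \<and>
    (\<forall>p\<in>M - N.
       (\<exists>\<gamma>. gradient_flow_line M A g f (-\<infinity>) \<infinity> \<gamma> \<and> \<gamma> 0 = p) \<and>
       (\<forall>\<gamma>. gradient_flow_line M A g f (-\<infinity>) \<infinity> \<gamma> \<and> \<gamma> 0 = p \<longrightarrow>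
          (\<exists>q. local_minimum A f q \<and> (\<gamma> \<longlongrightarrow> q) at_top)))"
proof -
  interpret compact_morse M A g f
    using assms by (rule compact_morse.intro)
  let ?S = "\<lambda>q. {\<gamma> 0 |\<gamma>. flow {0..} \<gamma> \<and> (\<gamma> \<longlongrightarrow> q) at_top}"
  let ?Q = "{q. critical_point A f q \<and> \<not> local_minimum A f q}"
  have "finite ?Q"
    by (rule finite_subset[OF _ finite_critical]) auto
  then have "measure_zero M A (\<Union>q\<in>?Q. ?S q)"
    using stable_set_measure_zero by (intro measure_zero_UN) (auto intro: countable_finite)
  moreover have "\<exists>q. local_minimum A f q \<and> (\<gamma> \<longlongrightarrow> q) at_top"
    if \<gamma>: "flow UNIV \<gamma>" "\<gamma> 0 \<notin> (\<Union>q\<in>?Q. ?S q)" for \<gamma>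
  proof -
    have flow: "flow {0..} \<gamma>" by (rule flow_subset[OF \<gamma>(1)]) simp
    then obtain q where "critical_point A f q" "(\<gamma> \<longlongrightarrow> q) at_top"
      using flow_converges by blast
    then show ?thesis using flow \<gamma>(2) by blast
  qed
  ultimately show ?thesis
    unfolding gradient_flow_line_UNIV using flow_exists by blast
qed

end
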